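(* Let $X$ be a Cantor space and let $CM(X)$ be the set of chain mixing maps in $C_s(X)$. Then $CM(X)$ is a conjugacy transitive subset of $C_s(X)$. There exists $f \in H(X)$ with $(X,f)$ minimal, which is a conjugacy transitive element of $CM(X)$. If $f$ is a conjugacy transitive element for $CM(X)$ then $f$ does not admit any periodic points. The set of weak mixing, minimal homeomorphisms which are conjugacy transitive elements of $CM(X)$ forms a dense $G_{\delta}$ subset of $CM(X)$.
   Context: A Cantor space is a nonempty, compact, zero-dimensional, perfect metric space (metric $d$). $C_s(X)$ is the space of continuous surjections $X\to X$ with the sup metric; $H(X)$ is the group of homeomorphisms, acting by $f\mapsto h\circ f\circ h^{-1}$, with orbits called conjugacy classes. With $V_\epsilon=\{(x,y):d(x,y)<\epsilon\}$ and maps identified with their graphs, $f$ is chain mixing if for every $\epsilon>0$ there is $N\ge1$ with $(V_\epsilon\circ f\circ V_\epsilon)^N=X\times X$ (composition of relations: $S\circ R=\{(x,z):\exists y,\ (x,y)\in R,(y,z)\in S\}$). $f$ is minimal if $\{f^i(x):i\ge1\}$ is dense in $X$ for every $x\in X$. $f$ is topologically transitive if for all nonempty open $U,V$ there is $n\ge1$ with $f^n(U)\cap V\ne\emptyset$, and weak mixing if $f\times f$ is topologically transitive on $X\times X$. A closed, conjugacy invariant $K\subset C_s(X)$ is conjugacy transitive if it is the closure of the conjugacy class of some $f\in K$; such an $f$ is a conjugacy transitive element of $K$. *)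

theory Defs
  imports "HOL-Analysis.Analysis"
begin

definition cantor_space :: "'a::metric_space set \<Rightarrow> bool" where
  "cantor_space X \<longleftrightarrow>
     X \<noteq> {} \<and> compact X \<and> top_of_set X dim_le 0 \<and> (\<forall>x\<in>X. x islimpt X)"

text \<open>
  The space \<open>X\<close> is the universe of the type \<open>'a\<close>. Since \<open>X\<close> is compact, the library type
  \<open>'a \<Rightarrow>\<^sub>C 'a\<close> of bounded continuous functions contains all continuous maps from \<open>X\<close> to \<open>X\<close>,
  and its \<open>dist\<close> is the sup metric.
\<close>

definition cont_surj :: "('a::metric_space \<Rightarrow>\<^sub>C 'a) set" where
  "cont_surj = {f. surj (apply_bcontfun f)}"

definition homeos :: "('a::metric_space \<Rightarrow>\<^sub>C 'a) set" where
  "homeos = {h. \<exists>k. homeomorphism UNIV UNIV (apply_bcontfun h) k}"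

definition conj_class :: "('a::metric_space \<Rightarrow>\<^sub>C 'a) \<Rightarrow> ('a \<Rightarrow>\<^sub>C 'a) set" where
  "conj_class f =
     {g. \<exists>h\<in>homeos. apply_bcontfun g = apply_bcontfun h \<circ> apply_bcontfun f \<circ> inv (apply_bcontfun h)}"

definition conj_invariant :: "('a::metric_space \<Rightarrow>\<^sub>C 'a) set \<Rightarrow> bool" where
  "conj_invariant K \<longleftrightarrow> (\<forall>f\<in>K. conj_class f \<subseteq> K)"

definition conj_transitive_element ::
    "('a::metric_space \<Rightarrow>\<^sub>C 'a) set \<Rightarrow> ('a \<Rightarrow>\<^sub>C 'a) \<Rightarrow> bool" where
  "conj_transitive_element K f \<longleftrightarrow> f \<in> K \<and> K = top_of_set cont_surj closure_of conj_class f"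

definition conj_transitive :: "('a::metric_space \<Rightarrow>\<^sub>C 'a) set \<Rightarrow> bool" where
  "conj_transitive K \<longleftrightarrow>
     closedin (top_of_set cont_surj) K \<and> conj_invariant K \<and> (\<exists>f. conj_transitive_element K f)"

definition entourage :: "real \<Rightarrow> ('a::metric_space \<times> 'a) set" where
  "entourage \<epsilon> = {(x, y). dist x y < \<epsilon>}"

definition graph_of :: "('a \<Rightarrow> 'b) \<Rightarrow> ('a \<times> 'b) set" where
  "graph_of f = {(x, y). y = f x}"

text \<open>
  The library composition \<open>R O S\<close> applies \<open>R\<close> first; the composite below reads the same in
  either convention.
\<close>

definition chain_mixing :: "('a::metric_space \<Rightarrow> 'a) \<Rightarrow> bool" where
  "chain_mixing f \<longleftrightarrow>
     (\<forall>\<epsilon>>0. \<exists>N\<ge>1. (entourage \<epsilon> O graph_of f O entourage \<epsilon>) ^^ N = UNIV)"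

definition CM :: "('a::metric_space \<Rightarrow>\<^sub>C 'a) set" where
  "CM = {f \<in> cont_surj. chain_mixing (apply_bcontfun f)}"

definition minimal_map :: "('a::topological_space \<Rightarrow> 'a) \<Rightarrow> bool" where
  "minimal_map f \<longleftrightarrow> (\<forall>x. closure {(f ^^ i) x | i. i \<ge> 1} = UNIV)"

definition topologically_transitive :: "('a::topological_space \<Rightarrow> 'a) \<Rightarrow> bool" where
  "topologically_transitive f \<longleftrightarrow>
     (\<forall>U V. open U \<and> open V \<and> U \<noteq> {} \<and> V \<noteq> {} \<longrightarrow> (\<exists>n\<ge>1. (f ^^ n) ` U \<inter> V \<noteq> {}))"

definition weak_mixing :: "('a::topological_space \<Rightarrow> 'a) \<Rightarrow> bool" where
  "weak_mixing f \<longleftrightarrow> topologically_transitive (map_prod f f)"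

definition periodic_point :: "('a \<Rightarrow> 'a) \<Rightarrow> 'a \<Rightarrow> bool" where
  "periodic_point f x \<longleftrightarrow> (\<exists>n\<ge>1. (f ^^ n) x = x)"

end

theory Submission
  imports Defs
begin

text \<open>
  The theorem rests on one observation: if \<open>m\<close> is \<^emph>\<open>any\<close> minimal homeomorphism of the Cantor
  space \<open>X\<close> and \<open>f\<close> is \<^emph>\<open>any\<close> chain mixing map, then \<open>m\<close> has conjugates arbitrarily close to
  \<open>f\<close> (\<open>minimal_conjugates_dense\<close>). To see this, cut \<open>X\<close> into small clopen cells and record
  the directed graph \<open>R\<close> with an edge from \<open>u\<close> to \<open>v\<close> if \<open>f\<close> sends some point of cell \<open>u\<close> into
  cell \<open>v\<close>. Every map that moves points along edges of \<open>R\<close> is close to \<open>f\<close>. Chain mixing makes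
  all large powers of \<open>R\<close> full, so through a fixed vertex there are closed walks of every large
  length that visit all vertices (\<open>long_visiting_walks\<close>). As \<open>m\<close> is minimal and \<open>X\<close> is infinite,
  \<open>m\<close> has no periodic points, hence there is a clopen set \<open>U\<close> all of whose return times are
  large, and they are bounded. So \<open>X\<close> is a finite union of towers over pieces of \<open>U\<close>;
  writing a closed walk of length \<open>h\<close> along each tower of height \<open>h\<close> gives a continuous map \<open>q\<close>
  from \<open>X\<close> onto the vertices such that \<open>m\<close> moves points along edges (\<open>tower_label\<close>). By Brouwer's
  characterization of the Cantor set all nonempty clopen sets are homeomorphic, so some
  homeomorphism carries the level sets of \<open>q\<close> onto the cells
  (\<open>homeomorphism_matching_labels\<close>), and it conjugates \<open>m\<close> to a map along edges of \<open>R\<close>.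

  Since \<open>CM\<close> is closed and conjugacy invariant, it follows that every minimal homeomorphism in
  \<open>CM\<close> is a conjugacy transitive element of \<open>CM\<close>. Hence the set in the last claim is just the set
  of minimal, weakly mixing homeomorphisms in \<open>CM\<close>. Each of these three properties is a
  countable intersection of open conditions: injectivity is tested on pairs of points at
  distance at least \<open>1 / n\<close>, minimality and weak mixing on the cells of countably many
  clopen partitions, and each single test involves boundedly many iterates. Density needs a
  single element of this set, as its conjugacy class stays in the set and is dense by
  the observation above; Baire category does not enter. Such an element is the two-sided
  Chacon subshift, transported to \<open>X\<close> by Brouwer's theorem; weak mixing implies
  chain mixing by Furstenberg's intersection lemma.

  Finally, a periodic point of \<open>f\<close> of period \<open>n\<close> gives one to all conjugates of \<open>f\<close> and, by
  compactness, to all their limits, but the minimal elements of \<open>CM\<close> have none.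
\<close>

section \<open>Addresses in a Cantor set and Brouwer's theorem\<close>

lemma continuous_on_locally_constant:
  assumes "\<And>x. x \<in> A \<Longrightarrow> \<exists>G. open G \<and> x \<in> G \<and> (\<forall>y\<in>A \<inter> G. f y = f x)"
  shows "continuous_on A f"
  unfolding continuous_on_topological
proof (intro ballI allI impI)
  fix x B assume "x \<in> A" "open B" "f x \<in> B"
  with assms[of x] show "\<exists>G. open G \<and> x \<in> G \<and> (\<forall>y\<in>A. y \<in> G \<longrightarrow> f y \<in> B)"
    by (metis IntI)
qed

text \<open>
  The topological description that Brouwer's theorem needs: the countable family of clopen
  sets that separates points stands for zero-dimensionality and metrizability. It does not
  mention a metric, so that it also applies to a set of sequences with the product
  topology.
\<close>
definition cantor_set :: "'b::topological_space set \<Rightarrow> bool" where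
  "cantor_set A \<longleftrightarrow> compact A \<and> A \<noteq> {} \<and> (\<forall>x\<in>A. x islimpt A) \<and>
     (\<exists>U::nat \<Rightarrow> 'b set. (\<forall>n. open (U n) \<and> closed (U n)) \<and>
        (\<forall>x\<in>A. \<forall>y\<in>A. x \<noteq> y \<longrightarrow> (\<exists>n. x \<in> U n \<longleftrightarrow> y \<notin> U n)))"

definition splits :: "'b set \<Rightarrow> 'b set \<Rightarrow> bool" where
  "splits W C \<longleftrightarrow> C \<inter> W \<noteq> {} \<and> C - W \<noteq> {}"

text \<open>
  The set at place \<open>n\<close> of the list is used whenever it cuts the cell, so that after
  \<open>n + 1\<close> steps no cell is cut by it any more; this is what makes addresses injective.
  Otherwise the cell is cut by any other member of the list, since every cell must have
  two children for addresses to be onto.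
\<close>
definition splitter :: "(nat \<Rightarrow> 'b set) \<Rightarrow> nat \<Rightarrow> 'b set \<Rightarrow> 'b set" where
  "splitter U n C = U (if splits (U n) C then n else SOME k. splits (U k) C)"

text \<open>
  The same binary tree of cells is described twice: \<open>cell\<close> follows a given branch \<open>b\<close>, and
  \<open>cell_of\<close> follows the branch of a given point.
\<close>
primrec cell :: "(nat \<Rightarrow> 'b set) \<Rightarrow> 'b set \<Rightarrow> (nat \<Rightarrow> bool) \<Rightarrow> nat \<Rightarrow> 'b set" where
  "cell U A b 0 = A"
| "cell U A b (Suc n) =
     (let C = cell U A b n in if b n then C \<inter> splitter U n C else C - splitter U n C)"

primrec cell_of :: "(nat \<Rightarrow> 'b set) \<Rightarrow> 'b set \<Rightarrow> 'b \<Rightarrow> nat \<Rightarrow> 'b set" where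
  "cell_of U A x 0 = A"
| "cell_of U A x (Suc n) =
     (let C = cell_of U A x n in if x \<in> splitter U n C then C \<inter> splitter U n C else C - splitter U n C)"

definition address :: "(nat \<Rightarrow> 'b set) \<Rightarrow> 'b set \<Rightarrow> 'b \<Rightarrow> nat \<Rightarrow> bool" where
  "address U A x n \<longleftrightarrow> x \<in> splitter U n (cell_of U A x n)"

lemma cell_address: "cell U A (address U A x) n = cell_of U A x n"
  by (induction n) (simp_all add: address_def Let_def)

lemma mem_cell_of: "x \<in> A \<Longrightarrow> x \<in> cell_of U A x n"
  by (induction n) (simp_all add: Let_def)

lemma cell_of_eq_cell:
  assumes "\<And>k. x \<in> cell U A b k"
  shows "cell_of U A x n = cell U A b n"
proof (induction n)
  case (Suc n)
  have "x \<in> cell U A b (Suc n)" by (rule assms)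
  with Suc show ?case by (auto simp: Let_def split: if_splits)
qed simp

lemma address_eq:
  assumes "\<And>k. x \<in> cell U A b k"
  shows "address U A x = b"
proof
  fix n
  have "x \<in> cell U A b (Suc n)" by (rule assms)
  then show "address U A x n = b n"
    by (simp add: address_def cell_of_eq_cell[OF assms] Let_def split: if_splits)
qed

lemma cell_of_cong:
  "y \<in> cell_of U A x n \<Longrightarrow> cell_of U A y n = cell_of U A x n"
proof (induction n)
  case (Suc n)
  then have "y \<in> cell_of U A x n" by (auto simp: Let_def split: if_splits)
  with Suc show ?case by (auto simp: Let_def split: if_splits)
qed simp

text \<open>
  Brouwer's theorem. The address map is onto because the cells along a branch are nested,
  nonempty and compact; it is injective because two points are separated by some set of
  the list, which cuts any cell that contains both; and it is locally constant in each
  coordinate. A continuous bijection from a compact space to a Hausdorff space is a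
  homeomorphism. Sequences of reals \<open>0\<close> and \<open>1\<close> are used because this product is a metric
  space, hence Hausdorff.
\<close>
lemma homeomorphic_binary_sequences:
  fixes A :: "'b::topological_space set"
  assumes "cantor_set A"
  shows "A homeomorphic {b :: nat \<Rightarrow> real. range b \<subseteq> {0, 1}}"
proof -
  have A: "compact A" "A \<noteq> {}" "\<And>x. x \<in> A \<Longrightarrow> x islimpt A"
    using assms by (auto simp: cantor_set_def)
  obtain U :: "nat \<Rightarrow> 'b set"
    where clU: "\<And>n. open (U n)" "\<And>n. closed (U n)"
      and sep: "\<And>x y. x \<in> A \<Longrightarrow> y \<in> A \<Longrightarrow> x \<noteq> y \<Longrightarrow> \<exists>n. x \<in> U n \<longleftrightarrow> y \<notin> U n"
    using assms unfolding cantor_set_def by metis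
  let ?D = "cell_of U A" and ?E = "cell U A"
  have clW: "open (splitter U n C)" "closed (splitter U n C)" for n C
    by (auto simp: splitter_def clU)
  have clE: "\<exists>G. open G \<and> closed G \<and> ?E b n = A \<inter> G" for b n
  proof (induction n)
    case 0 then show ?case by (intro exI[of _ UNIV]) auto
  next
    case (Suc n)
    then obtain G where G: "open G" "closed G" "?E b n = A \<inter> G" by auto
    let ?W = "splitter U n (A \<inter> G)"
    have "?E b (Suc n) = A \<inter> (if b n then G \<inter> ?W else G - ?W)"
      using G by (auto simp: Let_def)
    moreover have "open (if b n then G \<inter> ?W else G - ?W)" "closed (if b n then G \<inter> ?W else G - ?W)"
      using G clW by auto
    ultimately show ?case by blast
  qed
  \<comment> \<open>A cell is relatively open and \<open>A\<close> has no isolated points, so a nonempty cell has two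
    points.\<close>
  have splitter: "splits (splitter U n (?E b n)) (?E b n)" if ne: "?E b n \<noteq> {}" for b n
  proof -
    obtain G where G: "open G" "?E b n = A \<inter> G" using clE by blast
    then obtain x where x: "x \<in> A" "x \<in> G" using ne by blast
    from A(3)[OF x(1)] obtain y where y: "y \<in> A" "y \<in> G" "y \<noteq> x"
      using G x(2) by (metis islimptE)
    obtain k where "x \<in> U k \<longleftrightarrow> y \<notin> U k" using sep x y by metis
    then have "splits (U k) (?E b n)" using x y G by (auto simp: splits_def)
    then show ?thesis unfolding splitter_def by (auto intro: someI2)
  qed
  have nonempty: "?E b n \<noteq> {}" for b n
  proof (induction n)
    case (Suc n)
    from splitter[OF Suc] show ?case by (auto simp: splits_def Let_def)
  qed (use A in simp)
  have dec: "?E b (Suc n) \<subseteq> ?E b n" for b n by (auto simp: Let_def)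
  have surj: "\<exists>x\<in>A. address U A x = b" for b
  proof -
    have "A \<inter> \<Inter>(range (\<lambda>n. SOME G. closed G \<and> ?E b n = A \<inter> G)) \<noteq> {}"
    proof (rule compact_imp_fip)
      show "compact A" by (rule A)
    next
      fix T assume "T \<in> range (\<lambda>n. SOME G. closed G \<and> ?E b n = A \<inter> G)"
      then show "closed T" using clE by (smt (verit, best) imageE someI2_ex)
    next
      fix F' assume "finite F'" "F' \<subseteq> range (\<lambda>n. SOME G. closed G \<and> ?E b n = A \<inter> G)"
      then obtain I where I: "finite I" "F' = (\<lambda>n. SOME G. closed G \<and> ?E b n = A \<inter> G) ` I"
        by (meson finite_subset_image)
      have eq: "?E b n = A \<inter> (SOME G. closed G \<and> ?E b n = A \<inter> G)" for n
        using clE by (smt (verit, best) someI2_ex)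
      obtain N where N: "\<And>i. i \<in> I \<Longrightarrow> i \<le> N" using I(1) by (meson finite_nat_set_iff_bounded_le)
      have "?E b N \<subseteq> ?E b i" if "i \<le> N" for i
        using lift_Suc_antimono_le[of "?E b", OF dec that] .
      then have "?E b N \<subseteq> A \<inter> \<Inter>F'" using I N eq by blast
      then show "A \<inter> \<Inter>F' \<noteq> {}" using nonempty by blast
    qed
    then obtain x where x: "x \<in> A" "\<And>n. x \<in> (SOME G. closed G \<and> ?E b n = A \<inter> G)" by blast
    have "x \<in> ?E b n" for n
      using x clE[of b n] by (metis (mono_tags, lifting) IntI someI)
    then show ?thesis using x(1) address_eq by metis
  qed
  have inj: "inj_on (address U A) A"
  proof (rule inj_onI, rule ccontr)
    fix x y assume xy: "x \<in> A" "y \<in> A" "address U A x = address U A y" "x \<noteq> y"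
    have same: "?D x k = ?D y k" for k
      using xy(3) by (metis cell_address)
    obtain n where n: "x \<in> U n \<longleftrightarrow> y \<notin> U n" using sep xy by metis
    have "x \<in> ?D x n" "y \<in> ?D x n" using mem_cell_of xy same by metis+
    then have "splits (U n) (?D x n)" using n by (auto simp: splits_def)
    then have "splitter U n (?D x n) = U n" by (simp add: splitter_def)
    then have "address U A x n \<longleftrightarrow> x \<in> U n" "address U A y n \<longleftrightarrow> y \<in> U n"
      using same by (simp_all add: address_def)
    then show False using xy(3) n by simp
  qed
  let ?f = "\<lambda>x n. of_bool (address U A x n) :: real"
  have cont: "continuous_on A ?f"
  proof (rule continuous_on_coordinatewise_then_product)
    fix n
    have "\<exists>G. open G \<and> x \<in> G \<and> (\<forall>y\<in>A \<inter> G. address U A y n = address U A x n)" if xA: "x \<in> A" for x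
    proof -
      obtain G where G: "open G" "?D x (Suc n) = A \<inter> G"
        using clE[of "address U A x" "Suc n"] cell_address by metis
      have "address U A y n = address U A x n" if "y \<in> A \<inter> G" for y
      proof -
        have y: "y \<in> ?D x (Suc n)" using that G by simp
        then have "?D y n = ?D x n"
          by (intro cell_of_cong) (auto simp: Let_def split: if_splits)
        then show ?thesis using y by (auto simp: address_def Let_def split: if_splits)
      qed
      moreover have "x \<in> G" using mem_cell_of[OF xA, of U "Suc n"] G by auto
      ultimately show ?thesis using G by blast
    qed
    then show "continuous_on A (\<lambda>x. ?f x n)"
      by (intro continuous_on_locally_constant) (simp only: of_bool_eq_iff)
  qed
  have "\<exists>g. homeomorphism A {b :: nat \<Rightarrow> real. range b \<subseteq> {0, 1}} ?f g"
  proof (rule homeomorphism_compact[OF A(1) cont])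
    show "?f ` A = {b. range b \<subseteq> {0, 1}}"
    proof (intro equalityI subsetI)
      fix b :: "nat \<Rightarrow> real" assume b: "b \<in> {b. range b \<subseteq> {0, 1}}"
      obtain x where "x \<in> A" "address U A x = (\<lambda>n. b n = 1)" using surj by blast
      moreover have "of_bool (b n = 1) = b n" for n
        using b by (cases "b n = 1") auto
      ultimately show "b \<in> ?f ` A" by (intro image_eqI[of _ _ x]) auto
    qed auto
    show "inj_on ?f A"
      using inj by (simp only: inj_on_def fun_eq_iff of_bool_eq_iff)
  qed
  then show ?thesis by (auto simp: homeomorphic_def)
qed

section \<open>Clopen partitions as labels\<close>

text \<open>
  From here on, a finite clopen partition of a compact space \<open>X\<close> is represented by a
  continuous map \<open>p\<close> from \<open>X\<close> to the discrete space of natural numbers, called a label;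
  its cells are the fibres of \<open>p\<close>.
\<close>
lemma vimage_label_open:
  fixes p :: "'a::topological_space \<Rightarrow> nat"
  assumes "continuous_on UNIV p"
  shows "open (p -` S)" "closed (p -` S)"
proof -
  show "open (p -` S)" for S using assms by (simp add: open_vimage open_discrete)
  from this[of "- S"] show "closed (p -` S)" by (simp add: closed_def vimage_Compl)
qed

lemma finite_range_label:
  fixes p :: "'a::topological_space \<Rightarrow> nat"
  assumes "compact (UNIV :: 'a set)" "continuous_on UNIV p"
  shows "finite (range p)"
proof -
  obtain D where D: "finite D" "UNIV \<subseteq> (\<Union>v\<in>D. p -` {v})"
    by (rule compactE_image[OF assms(1), of UNIV "\<lambda>v. p -` {v}"])
       (use vimage_label_open[OF assms(2)] in auto)
  then have "range p \<subseteq> D" by auto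
  then show ?thesis using D(1) finite_subset by blast
qed

lemma label_gap:
  fixes p :: "'a::metric_space \<Rightarrow> nat"
  assumes "compact (UNIV :: 'a set)" "continuous_on UNIV p"
  shows "\<exists>d>0. \<forall>x y. dist x y < d \<longrightarrow> p x = p y"
proof -
  obtain d where d: "d > 0" "\<And>x. \<exists>G \<in> range (\<lambda>v. p -` {v}). ball x d \<subseteq> G"
    using Heine_Borel_lemma[OF assms(1), of "range (\<lambda>v. p -` {v})"] vimage_label_open[OF assms(2)]
    by (smt (verit, best) UNIV_I UN_iff imageE subsetI vimage_singleton_eq)
  have "p x = p y" if "dist x y < d" for x y
  proof -
    obtain v where "ball x d \<subseteq> p -` {v}" using d(2)[of x] by blast
    moreover have "x \<in> ball x d" "y \<in> ball x d" using that d(1) by auto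
    ultimately show ?thesis by blast
  qed
  then show ?thesis using d(1) by blast
qed

lemma continuous_on_Least:
  fixes Q :: "'a::topological_space \<Rightarrow> nat \<Rightarrow> bool"
  assumes op: "\<And>n. open {x. Q x n}" and cl: "\<And>n. closed {x. Q x n}" and ex: "\<And>x. \<exists>n. Q x n"
  shows "continuous_on UNIV (\<lambda>x. LEAST n. Q x n)"
proof (rule continuous_on_locally_constant)
  fix x
  let ?n = "LEAST n. Q x n"
  let ?G = "{y. Q y ?n} \<inter> (\<Inter>i\<in>{..<?n}. - {y. Q y i})"
  have "open (\<Inter>i\<in>{..<?n}. - {y. Q y i})"
    by (rule open_INT) (use cl in \<open>auto simp: closed_def\<close>)
  then have "open ?G" using op open_Int by blast
  moreover have "x \<in> ?G"
  proof -
    have "Q x ?n" using ex by (rule LeastI_ex)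
    moreover have "\<not> Q x i" if "i < ?n" for i using that by (rule not_less_Least)
    ultimately show ?thesis by blast
  qed
  moreover have "(LEAST n. Q y n) = ?n" if y: "y \<in> ?G" for y
  proof (rule Least_equality)
    show "Q y ?n" using y by blast
    show "?n \<le> i" if "Q y i" for i
    proof (rule leI, rule notI)
      assume "i < ?n"
      then show False using that y by blast
    qed
  qed
  ultimately show "\<exists>G. open G \<and> x \<in> G \<and> (\<forall>y\<in>UNIV \<inter> G. (LEAST n. Q y n) = ?n)"
    by blast
qed

text \<open>
  Finitely many clopen sets of small diameter cover \<open>X\<close>; a point is labelled by the first
  of them that contains it.
\<close>
lemma fine_label:
  assumes "cantor_space (UNIV :: 'a::metric_space set)" "e > 0"
  shows "\<exists>p :: 'a \<Rightarrow> nat. continuous_on UNIV p \<and> (\<forall>x y. p x = p y \<longrightarrow> dist x y < e)"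
proof -
  have "\<exists>W. open W \<and> closed W \<and> x \<in> W \<and> W \<subseteq> ball x (e/2)" for x :: 'a
  proof -
    have "neighbourhood_base_of (\<lambda>U. closed U \<and> open U) (euclidean :: 'a topology)"
      using assms(1) by (simp add: cantor_space_def dimension_le_0_neighbourhood_base_of_clopen)
    then have "\<exists>U V. open U \<and> (closed V \<and> open V) \<and> x \<in> U \<and> U \<subseteq> V \<and> V \<subseteq> ball x (e/2)"
      using assms(2) unfolding neighbourhood_base_of
      by (metis centre_in_ball half_gt_zero open_ball open_openin)
    then show ?thesis by blast
  qed
  then obtain W where W: "\<And>x::'a. open (W x)" "\<And>x. closed (W x)" "\<And>x. x \<in> W x"
      "\<And>x. W x \<subseteq> ball x (e/2)"
    by metis
  have "compact (UNIV :: 'a set)" using assms by (simp add: cantor_space_def)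
  then obtain T where T: "finite T" "UNIV \<subseteq> (\<Union>x\<in>T. W x)"
    by (rule compactE_image[of UNIV UNIV W]) (use W in auto)
  obtain ts where ts: "set ts = T" using T(1) finite_list by blast
  define p where "p x = (LEAST i. i < length ts \<and> x \<in> W (ts ! i))" for x
  have p: "p x < length ts" "x \<in> W (ts ! p x)" for x
  proof -
    have "\<exists>i. i < length ts \<and> x \<in> W (ts ! i)" using T ts by (metis UNIV_I UN_E in_set_conv_nth subsetD)
    from LeastI_ex[OF this] show "p x < length ts" "x \<in> W (ts ! p x)" by (auto simp: p_def)
  qed
  have "continuous_on UNIV p"
    unfolding p_def
  proof (rule continuous_on_Least)
    fix n
    show "open {x. n < length ts \<and> x \<in> W (ts ! n)}" "closed {x. n < length ts \<and> x \<in> W (ts ! n)}"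
      using W by (cases "n < length ts"; simp)+
    show "\<exists>n. n < length ts \<and> x \<in> W (ts ! n)" for x using p by blast
  qed
  moreover have "dist x y < e" if "p x = p y" for x y
  proof -
    have "x \<in> ball (ts ! p x) (e/2)" "y \<in> ball (ts ! p x) (e/2)" using p that W(4) by (metis subsetD)+
    then show ?thesis by (metis dist_commute dist_triangle_half_r mem_ball)
  qed
  ultimately show ?thesis by blast
qed

lemma cantor_set_vimage:
  fixes p :: "'a::metric_space \<Rightarrow> nat"
  assumes X: "cantor_space (UNIV :: 'a set)" and p: "continuous_on UNIV p" and v: "v \<in> range p"
  shows "cantor_set (p -` {v})"
proof -
  have "\<forall>n. \<exists>q :: 'a \<Rightarrow> nat. continuous_on UNIV q \<and> (\<forall>x y. q x = q y \<longrightarrow> dist x y < inverse (Suc n))"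
    by (intro allI fine_label[OF X]) simp
  then obtain q :: "nat \<Rightarrow> 'a \<Rightarrow> nat" where q: "\<And>n. continuous_on UNIV (q n)"
      "\<And>n x y. q n x = q n y \<Longrightarrow> dist x y < inverse (Suc n)"
    by metis
  define U where "U i = (case prod_decode i of (n, w) \<Rightarrow> q n -` {w})" for i
  have "open (U i) \<and> closed (U i)" for i
    using vimage_label_open[OF q(1)] by (auto simp: U_def split: prod.split)
  moreover have "\<exists>i. x \<in> U i \<longleftrightarrow> y \<notin> U i" if xy: "x \<noteq> y" for x y
  proof -
    obtain n where "inverse (Suc n) < dist x y" using xy reals_Archimedean[of "dist x y"] by auto
    then have "q n x \<noteq> q n y" using q(2) by fastforce
    then have "x \<in> U (prod_encode (n, q n x)) \<longleftrightarrow> y \<notin> U (prod_encode (n, q n x))" by (simp add: U_def)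
    then show ?thesis by blast
  qed
  moreover have "x islimpt p -` {v}" if "x \<in> p -` {v}" for x
  proof -
    have "x islimpt UNIV" using X by (simp add: cantor_space_def)
    then have "x islimpt UNIV \<inter> p -` {v}"
      by (rule islimpt_Int_eventually) (use vimage_label_open[OF p] that in \<open>auto simp: eventually_at_topological\<close>)
    then show ?thesis by simp
  qed
  moreover have "compact (p -` {v})"
    using X vimage_label_open(2)[OF p] compact_Int_closed[of UNIV "p -` {v}"] by (simp add: cantor_space_def)
  ultimately show ?thesis
    unfolding cantor_set_def using v by (intro conjI exI[of _ U] ballI allI impI) auto
qed

text \<open>
  Fibres with the same label are both Cantor sets, hence homeomorphic, and the
  homeomorphisms between them can be glued because the fibres are open.
\<close>
lemma homeomorphism_matching_labels:
  fixes p q :: "'a::metric_space \<Rightarrow> nat"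
  assumes X: "cantor_space (UNIV :: 'a set)"
    and p: "continuous_on UNIV p" and q: "continuous_on UNIV q" and "range p = range q"
  shows "\<exists>h k. homeomorphism UNIV UNIV h k \<and> (\<forall>x. p (h x) = q x)"
proof -
  have "(q -` {v}) homeomorphic (p -` {v})" if "v \<in> range p" for v
  proof -
    have "v \<in> range q" using that assms(4) by simp
    from homeomorphic_binary_sequences[OF cantor_set_vimage[OF X q this]]
      homeomorphic_binary_sequences[OF cantor_set_vimage[OF X p that], unfolded homeomorphic_sym[of "p -` {v}"]]
    show ?thesis by (rule homeomorphic_trans)
  qed
  then obtain h k where hk: "\<And>v. v \<in> range p \<Longrightarrow> homeomorphism (q -` {v}) (p -` {v}) (h v) (k v)"
    unfolding homeomorphic_def by metis
  define H where "H x = h (q x) x" for x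
  define K where "K x = k (p x) x" for x
  have qr: "q x \<in> range p" for x using assms(4) by auto
  have pH: "p (H x) = q x" for x
    using homeomorphism_image1[OF hk[OF qr[of x]]] by (auto simp: H_def)
  have qK: "q (K x) = p x" for x
    using homeomorphism_image2[OF hk[of "p x"]] by (auto simp: K_def)
  have glue: "continuous_on UNIV (\<lambda>x. f (r x) x)"
    if r: "continuous_on UNIV r" and f: "\<And>v. v \<in> range r \<Longrightarrow> continuous_on (r -` {v}) (f v)"
    for r :: "'a \<Rightarrow> nat" and f :: "nat \<Rightarrow> 'a \<Rightarrow> 'a"
  proof -
    have "continuous_on (\<Union>v\<in>range r. r -` {v}) (\<lambda>x. f (r x) x)"
    proof (rule continuous_on_open_UN)
      show "open (r -` {v})" for v by (rule vimage_label_open[OF r])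
      show "continuous_on (r -` {v}) (\<lambda>x. f (r x) x)" if "v \<in> range r" for v
        using f[OF that] by (rule continuous_on_eq) simp
    qed
    moreover have "(\<Union>v\<in>range r. r -` {v}) = UNIV" by auto
    ultimately show ?thesis by simp
  qed
  have "homeomorphism UNIV UNIV H K"
  proof (rule homeomorphismI)
    show "continuous_on UNIV H" unfolding H_def
      by (rule glue[OF q]) (use hk assms(4) in \<open>auto simp: homeomorphism_def\<close>)
    show "continuous_on UNIV K" unfolding K_def
      by (rule glue[OF p]) (use hk in \<open>auto simp: homeomorphism_def\<close>)
    show "K (H x) = x" for x
      using homeomorphism_apply1[OF hk[OF qr[of x]], of x] by (simp add: K_def pH) (simp add: H_def)
    show "H (K x) = x" for x
      using homeomorphism_apply2[OF hk[of "p x"], of x] by (simp add: H_def qK) (simp add: K_def)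
  qed auto
  then show ?thesis using pH by blast
qed

lemma continuous_imp_bcontfun:
  fixes f :: "'a::metric_space \<Rightarrow> 'a"
  assumes "compact (UNIV :: 'a set)" "continuous_on UNIV f"
  shows "\<exists>F. apply_bcontfun F = f"
proof -
  have "f \<in> bcontfun"
    using assms compact_continuous_image[OF assms(2,1)] by (simp add: bcontfun_def compact_imp_bounded)
  then show ?thesis by (metis bcontfunE)
qed

section \<open>Chain mixing, minimality and weak mixing\<close>

lemma continuous_on_funpow:
  fixes f :: "'a::topological_space \<Rightarrow> 'a"
  assumes "continuous_on UNIV f"
  shows "continuous_on UNIV (f ^^ n)"
proof (induction n)
  case (Suc n)
  have "continuous_on UNIV (f \<circ> (f ^^ n))"
    by (rule continuous_on_compose[OF Suc]) (use assms continuous_on_subset in blast)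
  then show ?case by simp
qed (simp add: id_def)

lemma funpow_uniformly_close:
  fixes f :: "'a::metric_space \<Rightarrow>\<^sub>C 'a"
  assumes cpt: "compact (UNIV :: 'a set)" and "e > 0"
  shows "\<exists>d>0. \<forall>g. dist f g < d \<longrightarrow> (\<forall>x. dist ((apply_bcontfun f ^^ n) x) ((apply_bcontfun g ^^ n) x) < e)"
  using \<open>e > 0\<close>
proof (induction n arbitrary: e)
  case 0
  then show ?case by (intro exI[of _ 1]) auto
next
  case (Suc n)
  have "uniformly_continuous_on UNIV f"
    using cpt by (intro compact_uniformly_continuous) auto
  then obtain r where r: "r > 0" "\<And>x y. dist x y < r \<Longrightarrow> dist (f x) (f y) < e / 2"
    using \<open>e > 0\<close> unfolding uniformly_continuous_on_def by (metis UNIV_I half_gt_zero)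
  obtain d where d: "d > 0" "\<And>g x. dist f g < d \<Longrightarrow> dist ((apply_bcontfun f ^^ n) x) ((apply_bcontfun g ^^ n) x) < r"
    using Suc.IH[OF r(1)] by blast
  have "dist ((apply_bcontfun f ^^ Suc n) x) ((apply_bcontfun g ^^ Suc n) x) < e" if g: "dist f g < min d (e / 2)" for g x
  proof -
    have "dist (f ((apply_bcontfun f ^^ n) x)) (f ((apply_bcontfun g ^^ n) x)) < e / 2" using d(2)[of g x] g r(2) by auto
    moreover have "dist (f ((apply_bcontfun g ^^ n) x)) (g ((apply_bcontfun g ^^ n) x)) < e / 2"
      using g by (intro dist_fun_lt_imp_dist_val_lt) auto
    ultimately show ?thesis
      using dist_triangle_half_r[of "f ((apply_bcontfun g ^^ n) x)" "f ((apply_bcontfun f ^^ n) x)" e "g ((apply_bcontfun g ^^ n) x)"]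
      by (simp add: dist_commute)
  qed
  then show ?case using d(1) Suc.prems by (intro exI[of _ "min d (e / 2)"]) auto
qed

lemma funpow_same_labels:
  fixes f :: "'a::metric_space \<Rightarrow>\<^sub>C 'a" and p :: "'a \<Rightarrow> nat"
  assumes cpt: "compact (UNIV :: 'a set)" and p: "continuous_on UNIV p"
  shows "\<exists>d>0. \<forall>g. dist f g < d \<longrightarrow> (\<forall>x. p ((apply_bcontfun g ^^ n) x) = p ((apply_bcontfun f ^^ n) x))"
proof -
  obtain r where "r > 0" "\<And>x y. dist x y < r \<Longrightarrow> p x = p y" using label_gap[OF cpt p] by blast
  then show ?thesis using funpow_uniformly_close[OF cpt, of r f n] by metis
qed

text \<open>
  The relation whose powers occur in the definition of chain mixing: one step of the map,
  with an error allowed before and after it.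
\<close>
definition chain_step :: "real \<Rightarrow> ('a::metric_space \<Rightarrow> 'a) \<Rightarrow> ('a \<times> 'a) set" where
  "chain_step e f = entourage e O graph_of f O entourage e"

lemma chain_step_iff:
  fixes f :: "'a::metric_space \<Rightarrow> 'a"
  shows "(x, y) \<in> chain_step e f \<longleftrightarrow> (\<exists>z. dist x z < e \<and> dist (f z) y < e)"
  by (auto simp: chain_step_def entourage_def graph_of_def)

lemma chain_mixing_iff:
  fixes f :: "'a::metric_space \<Rightarrow> 'a"
  shows "chain_mixing f \<longleftrightarrow> (\<forall>e>0. \<exists>N\<ge>1. \<forall>x y. (x, y) \<in> chain_step e f ^^ N)"
  unfolding chain_mixing_def chain_step_def by (simp add: set_eq_iff)

lemma relpow_map:
  fixes R :: "'a rel" and S :: "'b rel"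
  assumes "\<And>a b. (a, b) \<in> R \<Longrightarrow> (h a, h b) \<in> S" "(a, b) \<in> R ^^ n"
  shows "(h a, h b) \<in> S ^^ n"
  using assms(2)
proof (induction n arbitrary: b)
  case (Suc n)
  then obtain c where "(a, c) \<in> R ^^ n" "(c, b) \<in> R" by auto
  then show ?case using Suc.IH assms(1) by auto
qed auto

text \<open>
  A chain for a map within \<open>e/2\<close> of \<open>f\<close>, with errors \<open>e/2\<close>, is a chain for \<open>f\<close> with errors
  \<open>e\<close>.
\<close>
lemma closedin_CM: "closedin (top_of_set cont_surj) (CM :: ('a::metric_space \<Rightarrow>\<^sub>C 'a) set)"
proof -
  have "f \<in> CM" if f: "f \<in> cont_surj" "f \<in> closure CM" for f :: "'a \<Rightarrow>\<^sub>C 'a"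
  proof -
    have "\<exists>N\<ge>1. \<forall>x y. (x, y) \<in> chain_step e f ^^ N" if "e > 0" for e
    proof -
      obtain g where g: "g \<in> CM" "dist g f < e / 2"
        using f(2) \<open>e > 0\<close> by (meson closure_approachable half_gt_zero)
      have "chain_mixing (apply_bcontfun g)" using g(1) by (simp add: CM_def)
      then obtain N where N: "N \<ge> 1" "\<And>x y. (x, y) \<in> chain_step (e / 2) g ^^ N"
        using half_gt_zero[OF \<open>e > 0\<close>] unfolding chain_mixing_iff by blast
      have "(x, y) \<in> chain_step e f" if xy: "(x, y) \<in> chain_step (e / 2) g" for x y
      proof -
        obtain z where z: "dist x z < e / 2" "dist (g z) y < e / 2" using xy chain_step_iff by blast
        have "dist (f z) (g z) < e / 2" using g(2) by (intro dist_fun_lt_imp_dist_val_lt) (simp add: dist_commute)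
        then have "dist (f z) y < e" using z(2) dist_triangle_half_r[of "g z" "f z" e y] by (simp add: dist_commute)
        then show ?thesis using z(1) \<open>e > 0\<close> by (auto simp: chain_step_iff intro!: exI[of _ z])
      qed
      then have "(x, y) \<in> chain_step e f ^^ N" for x y
        using relpow_map[of "chain_step (e / 2) g" "\<lambda>x. x"] N(2) by blast
      then show ?thesis using N(1) by blast
    qed
    then show ?thesis using f(1) by (simp add: CM_def chain_mixing_iff)
  qed
  moreover have "CM \<subseteq> cont_surj" by (auto simp: CM_def)
  ultimately have "CM = cont_surj \<inter> closure (CM :: ('a \<Rightarrow>\<^sub>C 'a) set)"
    using closure_subset by blast
  then show ?thesis by (metis closed_closure closedin_closed)
qed

lemma conj_classE:
  assumes "g \<in> conj_class f"
  obtains h k where "homeomorphism UNIV UNIV h k" "\<And>x. g x = h (f (k x))"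
proof -
  obtain H k where H: "homeomorphism UNIV UNIV (apply_bcontfun H) k"
      "apply_bcontfun g = apply_bcontfun H \<circ> apply_bcontfun f \<circ> inv (apply_bcontfun H)"
    using assms by (auto simp: conj_class_def homeos_def)
  have "inv (apply_bcontfun H) = k"
    using H(1) by (intro inv_equality) (auto simp: homeomorphism_def)
  then show ?thesis using that[OF H(1)] H(2) by simp
qed

lemma conj_classI:
  fixes f g :: "'a::metric_space \<Rightarrow>\<^sub>C 'a"
  assumes "compact (UNIV :: 'a set)" and hk: "homeomorphism UNIV UNIV h k" and "\<And>x. g x = h (f (k x))"
  shows "g \<in> conj_class f"
proof -
  obtain H where H: "apply_bcontfun H = h"
    using continuous_imp_bcontfun[OF assms(1), of h] hk by (auto simp: homeomorphism_def)
  have "inv h = k" using hk by (intro inv_equality) (auto simp: homeomorphism_def)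
  then have "apply_bcontfun g = apply_bcontfun H \<circ> apply_bcontfun f \<circ> inv (apply_bcontfun H)"
    using assms(3) H by auto
  then show ?thesis using hk H unfolding conj_class_def homeos_def by blast
qed

lemma conj_class_CM:
  fixes f :: "'a::metric_space \<Rightarrow>\<^sub>C 'a"
  assumes cpt: "compact (UNIV :: 'a set)" and f: "f \<in> CM" and g: "g \<in> conj_class f"
  shows "g \<in> CM"
proof -
  obtain h k where hk: "homeomorphism UNIV UNIV h k" "\<And>x. g x = h (f (k x))"
    using conj_classE[OF g] by blast
  have inv: "h (k x) = x" "k (h x) = x" for x using hk(1) by (auto simp: homeomorphism_def)
  have "surj f" using f by (simp add: CM_def cont_surj_def)
  have "\<exists>x. y = g x" for y
  proof -
    obtain x where "k y = f x" using \<open>surj f\<close> by (meson surjD)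
    then have "y = g (h x)" using hk(2) inv by metis
    then show ?thesis by blast
  qed
  then have "surj g" by (auto simp: surj_def)
  moreover have "chain_mixing g"
    unfolding chain_mixing_iff
  proof (intro allI impI)
    fix e :: real assume "e > 0"
    have "uniformly_continuous_on UNIV h"
      using cpt hk(1) by (intro compact_uniformly_continuous) (auto simp: homeomorphism_def)
    then obtain d where d: "d > 0" "\<And>x y. dist x y < d \<Longrightarrow> dist (h x) (h y) < e"
      using \<open>e > 0\<close> unfolding uniformly_continuous_on_def by (metis UNIV_I)
    have "chain_mixing f" using f by (simp add: CM_def)
    then obtain N where N: "N \<ge> 1" "\<And>x y. (x, y) \<in> chain_step d f ^^ N"
      using d(1) unfolding chain_mixing_iff by blast
    have "(h x, h y) \<in> chain_step e g" if xy: "(x, y) \<in> chain_step d f" for x y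
    proof -
      obtain z where z: "dist x z < d" "dist (f z) y < d" using xy chain_step_iff by blast
      then show ?thesis using d(2) by (auto simp: chain_step_iff hk(2) inv intro!: exI[of _ "h z"])
    qed
    then have "(x, y) \<in> chain_step e g ^^ N" for x y
      using relpow_map[of "chain_step d f" h "chain_step e g" "k x" "k y" N] N(2) by (simp add: inv)
    then show "\<exists>N\<ge>1. \<forall>x y. (x, y) \<in> chain_step e g ^^ N" using N(1) by blast
  qed
  ultimately show ?thesis by (simp add: CM_def cont_surj_def)
qed

lemma minimal_map_iff:
  fixes f :: "'a::topological_space \<Rightarrow> 'a"
  shows
  "minimal_map f \<longleftrightarrow> (\<forall>x V. open V \<and> V \<noteq> {} \<longrightarrow> (\<exists>i\<ge>1. (f ^^ i) x \<in> V))"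
proof
  assume m: "minimal_map f"
  show "\<forall>x V. open V \<and> V \<noteq> {} \<longrightarrow> (\<exists>i\<ge>1. (f ^^ i) x \<in> V)"
  proof (intro allI impI)
    fix x and V :: "'a set" assume V: "open V \<and> V \<noteq> {}"
    have "V \<inter> closure {(f ^^ i) x | i. i \<ge> 1} \<noteq> {}" using m V by (simp add: minimal_map_def)
    then have "V \<inter> {(f ^^ i) x | i. i \<ge> 1} \<noteq> {}" using V open_Int_closure_eq_empty by blast
    then show "\<exists>i\<ge>1. (f ^^ i) x \<in> V" by auto
  qed
next
  assume r: "\<forall>x V. open V \<and> V \<noteq> {} \<longrightarrow> (\<exists>i\<ge>1. (f ^^ i) x \<in> V)"
  show "minimal_map f"
    unfolding minimal_map_def
  proof (intro allI)
    fix x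
    have "open (- closure {(f ^^ i) x | i. i \<ge> 1})" by (intro open_Compl closed_closure)
    moreover have "\<not> (\<exists>i\<ge>1. (f ^^ i) x \<in> - closure {(f ^^ i) x | i. i \<ge> 1})"
      using closure_subset[of "{(f ^^ i) x | i. i \<ge> 1}"] by auto
    ultimately show "closure {(f ^^ i) x | i. i \<ge> 1} = UNIV" using r by blast
  qed
qed

lemma funpow_map_prod:
  fixes f :: "'a \<Rightarrow> 'a" and g :: "'b \<Rightarrow> 'b"
  shows "(map_prod f g ^^ n) (x, y) = ((f ^^ n) x, (g ^^ n) y)"
  by (induction n) auto

lemma weak_mixing_iff:
  fixes f :: "'a::topological_space \<Rightarrow> 'a"
  shows
  "weak_mixing f \<longleftrightarrow> (\<forall>U V U' V'. open U \<and> open V \<and> open U' \<and> open V' \<and>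
     U \<noteq> {} \<and> V \<noteq> {} \<and> U' \<noteq> {} \<and> V' \<noteq> {} \<longrightarrow>
     (\<exists>n\<ge>1. (\<exists>x\<in>U. (f ^^ n) x \<in> V) \<and> (\<exists>x\<in>U'. (f ^^ n) x \<in> V')))" (is "_ \<longleftrightarrow> ?R")
proof
  assume w: "weak_mixing f"
  show ?R
  proof (intro allI impI)
    fix U V U' V' :: "'a set"
    assume *: "open U \<and> open V \<and> open U' \<and> open V' \<and> U \<noteq> {} \<and> V \<noteq> {} \<and> U' \<noteq> {} \<and> V' \<noteq> {}"
    then have "open (U \<times> U')" "open (V \<times> V')" "U \<times> U' \<noteq> {}" "V \<times> V' \<noteq> {}" by (auto intro: open_Times)
    then obtain n where "n \<ge> 1" "(map_prod f f ^^ n) ` (U \<times> U') \<inter> V \<times> V' \<noteq> {}"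
      using w unfolding weak_mixing_def topologically_transitive_def by meson
    then show "\<exists>n\<ge>1. (\<exists>x\<in>U. (f ^^ n) x \<in> V) \<and> (\<exists>x\<in>U'. (f ^^ n) x \<in> V')"
      by (fastforce simp: funpow_map_prod)
  qed
next
  assume r: ?R
  show "weak_mixing f"
    unfolding weak_mixing_def topologically_transitive_def
  proof (intro allI impI)
    fix A B :: "('a \<times> 'a) set" assume AB: "open A \<and> open B \<and> A \<noteq> {} \<and> B \<noteq> {}"
    then obtain a b where "a \<in> A" "b \<in> B" by blast
    obtain U U' where U: "open U" "open U'" "a \<in> U \<times> U'" "U \<times> U' \<subseteq> A"
      by (rule open_prod_elim[of A a]) (use AB \<open>a \<in> A\<close> in auto)
    obtain V V' where V: "open V" "open V'" "b \<in> V \<times> V'" "V \<times> V' \<subseteq> B"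
      by (rule open_prod_elim[of B b]) (use AB \<open>b \<in> B\<close> in auto)
    obtain n x x' where n: "n \<ge> 1" and x: "x \<in> U" "(f ^^ n) x \<in> V" "x' \<in> U'" "(f ^^ n) x' \<in> V'"
      using r[rule_format, of U V U' V'] U V by blast
    have "(x, x') \<in> A" "(map_prod f f ^^ n) (x, x') \<in> B" using x U V by (auto simp: funpow_map_prod)
    then have "(map_prod f f ^^ n) ` A \<inter> B \<noteq> {}" by blast
    then show "\<exists>n\<ge>1. (map_prod f f ^^ n) ` A \<inter> B \<noteq> {}" using n by blast
  qed
qed

lemma semiconj_funpow:
  fixes f :: "'a \<Rightarrow> 'a" and s :: "'b \<Rightarrow> 'b"
  assumes "\<And>x. h (f x) = s (h x)"
  shows "h ((f ^^ n) x) = (s ^^ n) (h x)"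
  by (induction n) (simp_all add: assms)

text \<open>
  Minimality and weak mixing pass through a conjugacy \<open>h\<close> from the whole space onto a
  subset \<open>Y\<close> of another space. It is used both for conjugate maps of \<open>X\<close> and for
  transporting the subshift to \<open>X\<close>, which is why the properties on \<open>Y\<close> are spelled out
  with relatively open sets.
\<close>
lemma conjugate_dynamics:
  fixes f :: "'a::topological_space \<Rightarrow> 'a" and s :: "'b::topological_space \<Rightarrow> 'b"
  assumes hk: "homeomorphism UNIV Y h k" and s: "\<And>y. y \<in> Y \<Longrightarrow> s y \<in> Y" and f: "\<And>x. f x = k (s (h x))"
  shows "(\<And>y W. y \<in> Y \<Longrightarrow> open W \<Longrightarrow> W \<inter> Y \<noteq> {} \<Longrightarrow> \<exists>i\<ge>1. (s ^^ i) y \<in> W) \<Longrightarrow> minimal_map f"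
    and "(\<And>A B C D. open A \<Longrightarrow> open B \<Longrightarrow> open C \<Longrightarrow> open D \<Longrightarrow>
       A \<inter> Y \<noteq> {} \<Longrightarrow> B \<inter> Y \<noteq> {} \<Longrightarrow> C \<inter> Y \<noteq> {} \<Longrightarrow> D \<inter> Y \<noteq> {} \<Longrightarrow>
       \<exists>n\<ge>1. (\<exists>x\<in>A \<inter> Y. (s ^^ n) x \<in> B) \<and> (\<exists>x\<in>C \<inter> Y. (s ^^ n) x \<in> D)) \<Longrightarrow> weak_mixing f"
proof -
  have hY: "h x \<in> Y" for x using hk by (auto simp: homeomorphism_def)
  have kh: "k (h x) = x" for x using hk by (auto simp: homeomorphism_def)
  have hk': "h (k y) = y" if "y \<in> Y" for y using hk that by (auto simp: homeomorphism_def)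
  have hf: "h ((f ^^ n) x) = (s ^^ n) (h x)" for n x
    by (rule semiconj_funpow) (simp add: f hk' s hY)
  have op: "\<exists>W. open W \<and> W \<inter> Y \<noteq> {} \<and> (\<forall>x. x \<in> V \<longleftrightarrow> h x \<in> W)" if V: "open V" "V \<noteq> {}" for V
  proof -
    have "openin (top_of_set Y) (h ` V)" using homeomorphism_imp_open_map[OF hk, of V] V by simp
    then obtain W where W: "open W" "h ` V = Y \<inter> W" by (auto simp: openin_open)
    then have "x \<in> V \<longleftrightarrow> h x \<in> W" for x by (metis IntD2 IntI hY image_iff kh)
    moreover have "W \<inter> Y \<noteq> {}" using W V by auto
    ultimately show ?thesis using W by blast
  qed
  show "minimal_map f" if m: "\<And>y W. y \<in> Y \<Longrightarrow> open W \<Longrightarrow> W \<inter> Y \<noteq> {} \<Longrightarrow> \<exists>i\<ge>1. (s ^^ i) y \<in> W"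
    unfolding minimal_map_iff
  proof (intro allI impI)
    fix x and V :: "'a set" assume "open V \<and> V \<noteq> {}"
    then obtain W where W: "open W" "W \<inter> Y \<noteq> {}" "\<And>x. x \<in> V \<longleftrightarrow> h x \<in> W" using op by metis
    then show "\<exists>i\<ge>1. (f ^^ i) x \<in> V" using m[OF hY W(1,2), of x] by (simp add: hf)
  qed
  show "weak_mixing f" if w: "\<And>A B C D. open A \<Longrightarrow> open B \<Longrightarrow> open C \<Longrightarrow> open D \<Longrightarrow>
       A \<inter> Y \<noteq> {} \<Longrightarrow> B \<inter> Y \<noteq> {} \<Longrightarrow> C \<inter> Y \<noteq> {} \<Longrightarrow> D \<inter> Y \<noteq> {} \<Longrightarrow>
       \<exists>n\<ge>1. (\<exists>x\<in>A \<inter> Y. (s ^^ n) x \<in> B) \<and> (\<exists>x\<in>C \<inter> Y. (s ^^ n) x \<in> D)"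
    unfolding weak_mixing_iff
  proof (intro allI impI)
    fix U V U' V' :: "'a set"
    assume *: "open U \<and> open V \<and> open U' \<and> open V' \<and> U \<noteq> {} \<and> V \<noteq> {} \<and> U' \<noteq> {} \<and> V' \<noteq> {}"
    obtain A where A: "open A" "A \<inter> Y \<noteq> {}" "\<And>x. x \<in> U \<longleftrightarrow> h x \<in> A" using op * by metis
    obtain B where B: "open B" "B \<inter> Y \<noteq> {}" "\<And>x. x \<in> V \<longleftrightarrow> h x \<in> B" using op * by metis
    obtain C where C: "open C" "C \<inter> Y \<noteq> {}" "\<And>x. x \<in> U' \<longleftrightarrow> h x \<in> C" using op * by metis
    obtain D where D: "open D" "D \<inter> Y \<noteq> {}" "\<And>x. x \<in> V' \<longleftrightarrow> h x \<in> D" using op * by metis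
    obtain n a c where n: "n \<ge> 1" "a \<in> A \<inter> Y" "(s ^^ n) a \<in> B" "c \<in> C \<inter> Y" "(s ^^ n) c \<in> D"
      using w[OF A(1) B(1) C(1) D(1) A(2) B(2) C(2) D(2)] by blast
    then have "k a \<in> U" "(f ^^ n) (k a) \<in> V" "k c \<in> U'" "(f ^^ n) (k c) \<in> V'"
      using A B C D by (simp_all add: hf hk')
    then show "\<exists>n\<ge>1. (\<exists>x\<in>U. (f ^^ n) x \<in> V) \<and> (\<exists>x\<in>U'. (f ^^ n) x \<in> V')" using n(1) by blast
  qed
qed

text \<open>
  Furstenberg's intersection lemma: the hitting times of some pair \<open>A, B\<close> are hitting
  times of all the given pairs at once. To add a pair \<open>U, V\<close>, weak mixing gives one \<open>k\<close>
  that moves points of \<open>A\<close> into \<open>U\<close> and points of \<open>B\<close> into \<open>V\<close>; the pair consisting of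
  \<open>A \<inter> f\<^sup>-\<^sup>k U\<close> and \<open>B \<inter> f\<^sup>-\<^sup>k V\<close> then does it,
  since \<open>f\<^sup>n\<close> and \<open>f\<^sup>k\<close> commute.
\<close>
lemma Furstenberg_intersection:
  fixes f :: "'a::topological_space \<Rightarrow> 'a"
  assumes w: "weak_mixing f" and f: "continuous_on UNIV f" and "finite Q"
    and "\<And>U V. (U, V) \<in> Q \<Longrightarrow> open U \<and> open V \<and> U \<noteq> {} \<and> V \<noteq> {}"
  shows "\<exists>A B. open A \<and> open B \<and> A \<noteq> {} \<and> B \<noteq> {} \<and>
     (\<forall>n U V. (\<exists>x\<in>A. (f ^^ n) x \<in> B) \<longrightarrow> (U, V) \<in> Q \<longrightarrow> (\<exists>x\<in>U. (f ^^ n) x \<in> V))"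
  using assms(3,4)
proof (induction Q rule: finite_induct)
  case empty
  show ?case by (intro exI[of _ UNIV]) auto
next
  case (insert q Q)
  obtain U V where q: "q = (U, V)" by fastforce
  have UV: "open U" "open V" "U \<noteq> {}" "V \<noteq> {}" using insert.prems[of U V] q by auto
  obtain A B where AB: "open A" "open B" "A \<noteq> {}" "B \<noteq> {}"
    and Q: "\<And>n U V. \<exists>x\<in>A. (f ^^ n) x \<in> B \<Longrightarrow> (U, V) \<in> Q \<Longrightarrow> \<exists>x\<in>U. (f ^^ n) x \<in> V"
    using insert.IH[OF insert.prems[OF insertI2]] by blast
  obtain k where k: "\<exists>x\<in>A. (f ^^ k) x \<in> U" "\<exists>x\<in>B. (f ^^ k) x \<in> V"
    using w[unfolded weak_mixing_iff, rule_format, of A U B V] AB UV by blast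
  have op: "open ((f ^^ k) -` W)" if "open W" for W
    using continuous_on_funpow[OF f, of k] that by (simp add: open_vimage)
  show ?case
  proof (intro exI conjI allI impI)
    show "open (A \<inter> (f ^^ k) -` U)" "open (B \<inter> (f ^^ k) -` V)" using AB UV op by auto
    show "A \<inter> (f ^^ k) -` U \<noteq> {}" "B \<inter> (f ^^ k) -` V \<noteq> {}" using k by auto
    fix n U' V' assume UV': "(U', V') \<in> insert q Q"
      and "\<exists>x\<in>A \<inter> (f ^^ k) -` U. (f ^^ n) x \<in> B \<inter> (f ^^ k) -` V"
    then obtain x where x: "x \<in> A" "(f ^^ k) x \<in> U" "(f ^^ n) x \<in> B" "(f ^^ k) ((f ^^ n) x) \<in> V" by auto
    have "(f ^^ n) ((f ^^ k) x) = (f ^^ k) ((f ^^ n) x)"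
      by (metis add.commute comp_apply funpow_add)
    then have "\<exists>x\<in>U. (f ^^ n) x \<in> V" using x by metis
    then show "\<exists>x\<in>U'. (f ^^ n) x \<in> V'" using UV' x q Q by blast
  qed
qed

text \<open>
  By Furstenberg's lemma a single time \<open>N\<close> serves all pairs of cells of a fine partition.
  An orbit segment of that length from the cell of \<open>x\<close> to the cell of \<open>y\<close> becomes a chain
  from \<open>x\<close> to \<open>y\<close> when its two ends are replaced by \<open>x\<close> and \<open>y\<close>.
\<close>
lemma weak_mixing_imp_chain_mixing:
  fixes f :: "'a::metric_space \<Rightarrow> 'a"
  assumes X: "cantor_space (UNIV :: 'a set)" and f: "continuous_on UNIV f" and w: "weak_mixing f"
  shows "chain_mixing f"
  unfolding chain_mixing_iff
proof (intro allI impI)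
  fix e :: real assume "e > 0"
  then obtain p :: "'a \<Rightarrow> nat" where p: "continuous_on UNIV p" "\<And>x y. p x = p y \<Longrightarrow> dist x y < e"
    using fine_label[OF X] by blast
  have fin: "finite (range p)" using finite_range_label[OF _ p(1)] X by (simp add: cantor_space_def)
  let ?Q = "(\<lambda>(u, v). (p -` {u}, p -` {v})) ` (range p \<times> range p)"
  obtain A B where AB: "open A" "open B" "A \<noteq> {}" "B \<noteq> {}"
    and Q: "\<And>n U V. \<exists>x\<in>A. (f ^^ n) x \<in> B \<Longrightarrow> (U, V) \<in> ?Q \<Longrightarrow> \<exists>x\<in>U. (f ^^ n) x \<in> V"
  proof -
    have "finite ?Q" using fin by simp
    moreover have "open U \<and> open V \<and> U \<noteq> {} \<and> V \<noteq> {}" if "(U, V) \<in> ?Q" for U V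
      using that vimage_label_open[OF p(1)] by auto
    ultimately have "\<exists>A B. open A \<and> open B \<and> A \<noteq> {} \<and> B \<noteq> {} \<and>
        (\<forall>n U V. (\<exists>x\<in>A. (f ^^ n) x \<in> B) \<longrightarrow> (U, V) \<in> ?Q \<longrightarrow> (\<exists>x\<in>U. (f ^^ n) x \<in> V))"
      by (rule Furstenberg_intersection[OF w f])
    then show ?thesis using that by blast
  qed
  obtain N where N: "N \<ge> 1" "\<exists>x\<in>A. (f ^^ N) x \<in> B"
    using w[unfolded weak_mixing_iff, rule_format, of A B A B] AB by blast
  have "(x, y) \<in> chain_step e f ^^ N" for x y
  proof -
    have "(p -` {p x}, p -` {p y}) \<in> ?Q" by auto
    then obtain z where z: "p z = p x" "p ((f ^^ N) z) = p y" using Q[OF N(2), of "p -` {p x}" "p -` {p y}"] by blast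
    define c where "c i = (if i = 0 then x else if i = N then y else (f ^^ i) z)" for i
    have near: "dist (c i) ((f ^^ i) z) < e" if "i \<le> N" for i
      using z p(2)[of x z] p(2)[of y "(f ^^ N) z"] \<open>e > 0\<close> by (auto simp: c_def)
    have "(c i, c (Suc i)) \<in> chain_step e f" if "i < N" for i
      unfolding chain_step_iff
      using near[of i] near[of "Suc i"] that by (intro exI[of _ "(f ^^ i) z"]) (auto simp: dist_commute)
    then have "(c 0, c N) \<in> chain_step e f ^^ N" by (auto simp: relpow_fun_conv)
    then show ?thesis using N(1) by (simp add: c_def)
  qed
  then show "\<exists>N\<ge>1. \<forall>x y. (x, y) \<in> chain_step e f ^^ N" using N(1) by blast
qed

section \<open>Conjugates of a minimal homeomorphism near a chain mixing map\<close>

definition visiting_walk :: "'v rel \<Rightarrow> nat \<Rightarrow> 'v \<Rightarrow> 'v \<Rightarrow> 'v set \<Rightarrow> (nat \<Rightarrow> 'v) \<Rightarrow> bool" where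
  "visiting_walk R m u v A c \<longleftrightarrow>
     c 0 = u \<and> c m = v \<and> (\<forall>i<m. (c i, c (Suc i)) \<in> R) \<and> A \<subseteq> c ` {..m}"

lemma visiting_walk_append:
  assumes c: "visiting_walk R m u v A c" and d: "visiting_walk R n v w B d"
  shows "visiting_walk R (m + n) u w (A \<union> B) (\<lambda>i. if i \<le> m then c i else d (i - m))"
    (is "visiting_walk _ _ _ _ _ ?e")
proof -
  have c: "c 0 = u" "c m = v" "\<And>i. i < m \<Longrightarrow> (c i, c (Suc i)) \<in> R" "A \<subseteq> c ` {..m}"
    and d: "d 0 = v" "d n = w" "\<And>i. i < n \<Longrightarrow> (d i, d (Suc i)) \<in> R" "B \<subseteq> d ` {..n}"
    using assms by (auto simp: visiting_walk_def)
  have e_d: "?e (m + i) = d i" for i using c(2) d(1) by auto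
  have "(?e i, ?e (Suc i)) \<in> R" if "i < m + n" for i
  proof (cases "i < m")
    case True then show ?thesis using c(3) by simp
  next
    case False
    define r where "r = i - m"
    then have r: "i = m + r" "r < n" using False that by auto
    then show ?thesis using d(3)[of r] e_d[of r] e_d[of "Suc r"] by (simp only: add_Suc_right)
  qed
  moreover have "A \<subseteq> ?e ` {..m + n}"
  proof
    fix a assume "a \<in> A"
    then obtain i where "i \<le> m" "a = c i" using c(4) by auto
    then show "a \<in> ?e ` {..m + n}" by (intro image_eqI[of _ _ i]) auto
  qed
  moreover have "B \<subseteq> ?e ` {..m + n}"
  proof
    fix b assume "b \<in> B"
    then obtain i where "i \<le> n" "b = d i" using d(4) by auto
    then show "b \<in> ?e ` {..m + n}" using e_d[of i] by (intro image_eqI[of _ _ "m + i"]) auto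
  qed
  moreover have "?e 0 = u" "?e (m + n) = w" using c(1) d(2) e_d[of n] by simp_all
  ultimately show ?thesis unfolding visiting_walk_def by simp
qed

lemma visiting_walk_relpow:
  assumes "(u, v) \<in> R ^^ n"
  shows "\<exists>c. visiting_walk R n u v {v} c"
proof -
  obtain c where "c 0 = u" "c n = v" "\<forall>i<n. (c i, c (Suc i)) \<in> R"
    using assms unfolding relpow_fun_conv by blast
  then show ?thesis unfolding visiting_walk_def by (intro exI[of _ c]) auto
qed

text \<open>
  A detour from \<open>v0\<close> to one more vertex and back can be made in exactly \<open>N + N\<close> steps, so
  it can be appended to a closed walk of any large length.
\<close>
lemma long_visiting_walks:
  assumes full: "\<And>m u v. m \<ge> N \<Longrightarrow> u \<in> P \<Longrightarrow> v \<in> P \<Longrightarrow> (u, v) \<in> R ^^ m"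
    and "finite A" "A \<subseteq> P" "v0 \<in> P"
  shows "\<exists>M. \<forall>m\<ge>M. \<exists>c. visiting_walk R m v0 v0 A c"
  using \<open>finite A\<close> \<open>A \<subseteq> P\<close>
proof (induction A rule: finite_induct)
  case empty
  have "\<exists>c. visiting_walk R m v0 v0 {} c" if "m \<ge> N" for m
    using visiting_walk_relpow[OF full[OF that \<open>v0 \<in> P\<close> \<open>v0 \<in> P\<close>]] by (auto simp: visiting_walk_def)
  then show ?case by blast
next
  case (insert a A)
  then obtain M where M: "\<And>m. m \<ge> M \<Longrightarrow> \<exists>c. visiting_walk R m v0 v0 A c" by auto
  have "\<exists>c. visiting_walk R m v0 v0 (insert a A) c" if m: "m \<ge> M + (N + N)" for m
  proof -
    have "m - (N + N) \<ge> M" using m by simp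
    then obtain c where c: "visiting_walk R (m - (N + N)) v0 v0 A c" using M by blast
    obtain d where d: "visiting_walk R N v0 a {a} d"
      using visiting_walk_relpow[OF full[of N v0 a]] insert.prems \<open>v0 \<in> P\<close> by auto
    obtain e where e: "visiting_walk R N a v0 {v0} e"
      using visiting_walk_relpow[OF full[of N a v0]] insert.prems \<open>v0 \<in> P\<close> by auto
    from visiting_walk_append[OF c visiting_walk_append[OF d e]]
    obtain c' where "visiting_walk R (m - (N + N) + (N + N)) v0 v0 (A \<union> ({a} \<union> {v0})) c'" by blast
    moreover have "m - (N + N) + (N + N) = m" using m by simp
    ultimately have "visiting_walk R m v0 v0 (insert a A) c'"
      unfolding visiting_walk_def by simp
    then show ?thesis by blast
  qed
  then show ?case by blast
qed

text \<open>
  A periodic orbit is finite, hence closed; by minimality it would be the whole space,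
  which has limit points.
\<close>
lemma minimal_no_periodic_point:
  fixes f :: "'a::metric_space \<Rightarrow> 'a"
  assumes X: "cantor_space (UNIV :: 'a set)" and m: "minimal_map f"
  shows "\<not> periodic_point f x"
proof
  assume "periodic_point f x"
  then obtain n where n: "n \<ge> 1" "(f ^^ n) x = x" by (auto simp: periodic_point_def)
  have "{(f ^^ i) x | i. i \<ge> 1} \<subseteq> (\<lambda>i. (f ^^ i) x) ` {..<n}"
  proof safe
    fix i :: nat
    have "(f ^^ i) x = (f ^^ (i mod n)) x" using funpow_mod_eq[OF n(2)] by simp
    then show "(f ^^ i) x \<in> (\<lambda>i. (f ^^ i) x) ` {..<n}" using n(1) by (intro image_eqI[of _ _ "i mod n"]) auto
  qed
  then have fin: "finite {(f ^^ i) x | i. i \<ge> 1}" by (rule finite_subset) simp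
  then have "closure {(f ^^ i) x | i. i \<ge> 1} = {(f ^^ i) x | i. i \<ge> 1}"
    by (intro closure_closed finite_imp_closed)
  then have "finite (UNIV :: 'a set)" using m fin unfolding minimal_map_def by metis
  moreover have "x islimpt UNIV" using X by (simp add: cantor_space_def)
  ultimately show False using islimpt_finite by blast
qed

text \<open>
  A nonperiodic point differs from its first iterates, so a small enough clopen
  neighbourhood of it is disjoint from its own first preimages.
\<close>
lemma clopen_long_return:
  fixes f :: "'a::metric_space \<Rightarrow> 'a"
  assumes X: "cantor_space (UNIV :: 'a set)" and f: "continuous_on UNIV f" and x0: "\<not> periodic_point f x0"
  shows "\<exists>U. open U \<and> closed U \<and> x0 \<in> U \<and> (\<forall>x\<in>U. \<forall>i. 1 \<le> i \<and> i < M \<longrightarrow> (f ^^ i) x \<notin> U)"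
proof (induction M)
  case 0
  show ?case by (intro exI[of _ UNIV]) auto
next
  case (Suc M)
  then obtain U where U: "open U" "closed U" "x0 \<in> U" "\<And>x i. x \<in> U \<Longrightarrow> 1 \<le> i \<Longrightarrow> i < M \<Longrightarrow> (f ^^ i) x \<notin> U"
    by blast
  show ?case
  proof (cases "M = 0")
    case True
    then show ?thesis using U by (intro exI[of _ U]) auto
  next
    case False
    then have "(f ^^ M) x0 \<noteq> x0" using x0 by (auto simp: periodic_point_def)
    then have "dist x0 ((f ^^ M) x0) > 0" by auto
    then obtain p :: "'a \<Rightarrow> nat" where p1: "continuous_on UNIV p"
        "\<And>x y. p x = p y \<Longrightarrow> dist x y < dist x0 ((f ^^ M) x0)"
      using fine_label[OF X] by meson
    have p: "continuous_on UNIV p" "p x0 \<noteq> p ((f ^^ M) x0)" using p1 by auto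
    let ?W = "p -` {p x0}" and ?F = "f ^^ M"
    have W: "open ?W" "closed ?W" by (rule vimage_label_open[OF p(1)])+
    have F: "continuous_on UNIV ?F" by (rule continuous_on_funpow[OF f])
    have FW: "open (?F -` ?W)" "closed (?F -` ?W)"
      using W F by (auto intro: open_vimage closed_vimage)
    show ?thesis
    proof (intro exI conjI ballI allI impI)
      show "open (U \<inter> (?W - ?F -` ?W))" "closed (U \<inter> (?W - ?F -` ?W))"
        using U W FW by (auto intro: open_Int open_Diff closed_Int closed_Diff)
      show "x0 \<in> U \<inter> (?W - ?F -` ?W)" using U p(2) by auto
      fix x i assume x: "x \<in> U \<inter> (?W - ?F -` ?W)" and i: "1 \<le> i \<and> i < Suc M"
      show "(f ^^ i) x \<notin> U \<inter> (?W - ?F -` ?W)"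
        using x i U(4)[of x i] by (cases "i = M") auto
    qed
  qed
qed

lemma bounded_return:
  fixes f :: "'a::topological_space \<Rightarrow> 'a"
  assumes cpt: "compact (UNIV :: 'a set)" and f: "continuous_on UNIV f" and U: "open U"
    and hit: "\<And>x. \<exists>i\<ge>1. (f ^^ i) x \<in> U"
  shows "\<exists>N. \<forall>x. \<exists>i. 1 \<le> i \<and> i \<le> N \<and> (f ^^ i) x \<in> U"
proof -
  obtain D where D: "D \<subseteq> {1..}" "finite D" "UNIV \<subseteq> (\<Union>i\<in>D. (f ^^ i) -` U)"
  proof (rule compactE_image[OF cpt, of "{1..}" "\<lambda>i. (f ^^ i) -` U"])
    show "open ((f ^^ i) -` U)" for i using continuous_on_funpow[OF f] U by (simp add: open_vimage)
    show "UNIV \<subseteq> (\<Union>i\<in>{1..}. (f ^^ i) -` U)"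
    proof
      fix x
      obtain i where "i \<ge> 1" "(f ^^ i) x \<in> U" using hit by blast
      then show "x \<in> (\<Union>i\<in>{1..}. (f ^^ i) -` U)" by (intro UN_I[of i]) auto
    qed
  qed auto
  obtain N where "\<forall>i\<in>D. i \<le> N" using D(2) by (meson finite_nat_set_iff_bounded_le)
  then have "\<exists>i. 1 \<le> i \<and> i \<le> N \<and> (f ^^ i) x \<in> U" for x
  proof -
    obtain i where "i \<in> D" "(f ^^ i) x \<in> U" using D(3) by auto
    then show ?thesis using D(1) \<open>\<forall>i\<in>D. i \<le> N\<close> by (intro exI[of _ i]) auto
  qed
  then show ?thesis by blast
qed

lemma funpow_inverse:
  fixes f g :: "'a \<Rightarrow> 'a"
  assumes "\<And>x. f (g x) = x"
  shows "(f ^^ i) ((g ^^ i) x) = x"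
  by (induction i arbitrary: x) (simp_all add: funpow_swap1 assms)

text \<open>
  The towers over \<open>U\<close>: a point \<open>x\<close> lies on level \<open>j x\<close>, the time since its last visit to
  \<open>U\<close>, and reaches \<open>U\<close> again after \<open>Suc (k x)\<close> steps, so that its tower has height
  \<open>j x + Suc (k x)\<close>. The label \<open>q x\<close> is the vertex at position \<open>j x\<close> of the closed walk
  whose length is that height. Inside a tower \<open>f\<close> moves one step along the walk; from the
  top of a tower it moves to the bottom of another one, which is labelled by the common
  base vertex \<open>v0\<close> at which the walk ends.
\<close>
lemma tower_label:
  fixes f g :: "'a::topological_space \<Rightarrow> 'a" and c :: "nat \<Rightarrow> nat \<Rightarrow> nat"
  assumes cpt: "compact (UNIV :: 'a set)" and fg: "homeomorphism UNIV UNIV f g" and m: "minimal_map f"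
    and U: "open U" "closed U" "U \<noteq> {}"
    and ret: "\<And>x i. x \<in> U \<Longrightarrow> 1 \<le> i \<Longrightarrow> i < M \<Longrightarrow> (f ^^ i) x \<notin> U"
    and c: "\<And>m. m \<ge> M \<Longrightarrow> visiting_walk R m v0 v0 P (c m)"
  shows "\<exists>q. continuous_on UNIV q \<and> (\<forall>x. (q x, q (f x)) \<in> R) \<and> P \<subseteq> range q"
proof -
  have inv: "f (g x) = x" "g (f x) = x" for x using fg by (auto simp: homeomorphism_def)
  have cf: "continuous_on UNIV f" and cg: "continuous_on UNIV g" using fg by (auto simp: homeomorphism_def)
  obtain N where N: "\<And>x. \<exists>i. 1 \<le> i \<and> i \<le> N \<and> (f ^^ i) x \<in> U"
    using bounded_return[OF cpt cf U(1)] m U unfolding minimal_map_iff by blast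
  define j where "j x = (LEAST i. (g ^^ i) x \<in> U)" for x
  define k where "k x = (LEAST i. (f ^^ Suc i) x \<in> U)" for x
  have exk: "\<exists>i. (f ^^ Suc i) x \<in> U" for x
  proof -
    obtain i where "1 \<le> i" "(f ^^ i) x \<in> U" using N by blast
    then show ?thesis by (intro exI[of _ "i - 1"]) (simp del: funpow.simps)
  qed
  \<comment> \<open>The last visit exists because return times are bounded: the orbit of \<open>g\<^sup>N x\<close> meets
    \<open>U\<close> by the time it reaches \<open>x\<close>.\<close>
  have exj: "\<exists>i. (g ^^ i) x \<in> U" for x
  proof -
    obtain i where i: "i \<le> N" "(f ^^ i) ((g ^^ N) x) \<in> U" using N by blast
    have "(g ^^ N) x = (g ^^ i) ((g ^^ (N - i)) x)"
      using i(1) by (metis comp_apply funpow_add le_add_diff_inverse)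
    then have "(f ^^ i) ((g ^^ N) x) = (g ^^ (N - i)) x" using funpow_inverse[of f g] inv by simp
    then show ?thesis using i(2) by metis
  qed
  have gj: "(g ^^ j x) x \<in> U" for x using LeastI_ex[OF exj[of x]] by (simp add: j_def)
  have fk: "(f ^^ Suc (k x)) x \<in> U" for x using LeastI_ex[OF exk[of x]] unfolding k_def .
  have cj: "continuous_on UNIV j"
    unfolding j_def
    by (rule continuous_on_Least)
       (use exj U continuous_on_funpow[OF cg] in \<open>auto simp flip: vimage_def intro: open_vimage closed_vimage\<close>)
  have ck: "continuous_on UNIV k"
    unfolding k_def
    by (rule continuous_on_Least)
       (use exk U continuous_on_funpow[OF cf, of "Suc _"] in \<open>auto simp flip: vimage_def simp del: funpow.simps intro: open_vimage closed_vimage\<close>)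
  define q where "q x = c (j x + Suc (k x)) (j x)" for x
  have long: "j x + Suc (k x) \<ge> M" for x
  proof (rule ccontr)
    assume "\<not> j x + Suc (k x) \<ge> M"
    moreover have "(f ^^ (j x + Suc (k x))) ((g ^^ j x) x) = (f ^^ Suc (k x)) x"
      using funpow_inverse[of f g "j x" x] inv by (metis add.commute comp_apply funpow_add)
    ultimately show False using ret[OF gj[of x], of "j x + Suc (k x)"] fk[of x] by simp
  qed
  have step0: "j (f x) = 0" if "k x = 0" for x
  proof -
    have "f x \<in> U" using fk[of x] that by simp
    then show ?thesis unfolding j_def by (intro Least_eq_0) simp
  qed
  have stepS: "j (f x) = Suc (j x) \<and> k (f x) = r" if k: "k x = Suc r" for x r
  proof
    have n: "f x \<notin> U"
      using not_less_Least[of 0 "\<lambda>i. (f ^^ Suc i) x \<in> U"] k unfolding k_def by simp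
    have "j (f x) = Suc (LEAST i. (g ^^ Suc i) (f x) \<in> U)"
      unfolding j_def
      by (rule Least_Suc[where P = "\<lambda>i. (g ^^ i) (f x) \<in> U", OF gj[of "f x"]]) (use n in simp)
    moreover have "(g ^^ Suc i) (f x) = (g ^^ i) x" for i
      by (simp add: funpow_Suc_right inv del: funpow.simps)
    ultimately show "j (f x) = Suc (j x)" by (simp only: j_def)
    have "k x = Suc (LEAST i. (f ^^ Suc (Suc i)) x \<in> U)"
      unfolding k_def
      by (rule Least_Suc[where P = "\<lambda>i. (f ^^ Suc i) x \<in> U", OF fk]) (use n in simp)
    moreover have "(f ^^ Suc (Suc i)) x = (f ^^ Suc i) (f x)" for i
      by (simp only: funpow_Suc_right comp_apply)
    ultimately show "k (f x) = r" using k by (simp only: k_def nat.inject)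
  qed
  have "(q x, q (f x)) \<in> R" for x
  proof -
    have w: "visiting_walk R (j x + Suc (k x)) v0 v0 P (c (j x + Suc (k x)))" by (rule c[OF long])
    have w': "visiting_walk R (j (f x) + Suc (k (f x))) v0 v0 P (c (j (f x) + Suc (k (f x))))" by (rule c[OF long])
    show ?thesis
    proof (cases "k x")
      case 0
      then show ?thesis using w w' step0[OF 0] by (auto simp: q_def visiting_walk_def)
    next
      case (Suc r)
      then show ?thesis using w stepS[OF Suc] by (auto simp: q_def visiting_walk_def)
    qed
  qed
  moreover have "P \<subseteq> range q"
  proof
    fix v assume "v \<in> P"
    obtain x0 where x0: "x0 \<in> U" using U by blast
    let ?m = "Suc (k x0)"
    have j0: "j x0 = 0" unfolding j_def using x0 by (intro Least_eq_0) simp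
    have w: "visiting_walk R ?m v0 v0 P (c ?m)" using c[OF long[of x0]] j0 by simp
    have "i < ?m \<Longrightarrow> j ((f ^^ i) x0) = i \<and> i + Suc (k ((f ^^ i) x0)) = ?m" for i
    proof (induction i)
      case (Suc i)
      then have "j ((f ^^ i) x0) = i" "i + Suc (k ((f ^^ i) x0)) = ?m" by auto
      then show ?case using stepS[of "(f ^^ i) x0" "k x0 - Suc i"] Suc.prems by auto
    qed (simp add: j0)
    then have q: "q ((f ^^ i) x0) = c ?m i" if "i < ?m" for i using that by (simp add: q_def)
    obtain i where i: "i \<le> ?m" "v = c ?m i" using w \<open>v \<in> P\<close> by (auto simp: visiting_walk_def)
    \<comment> \<open>The walk has \<open>?m + 1\<close> positions but the tower only \<open>?m\<close> levels; the last position
      repeats the first.\<close>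
    have "\<exists>i<?m. v = c ?m i"
    proof (cases "i = ?m")
      case True
      then have "v = c ?m 0" using i(2) w by (simp add: visiting_walk_def)
      then show ?thesis by blast
    next
      case False
      then show ?thesis using i by (intro exI[of _ i]) auto
    qed
    then show "v \<in> range q" using q by (metis rangeI)
  qed
  moreover have "continuous_on UNIV q"
  proof (rule continuous_on_locally_constant)
    fix x
    show "\<exists>G. open G \<and> x \<in> G \<and> (\<forall>y\<in>UNIV \<inter> G. q y = q x)"
      using vimage_label_open(1)[OF cj, of "{j x}"] vimage_label_open(1)[OF ck, of "{k x}"]
      by (intro exI[of _ "j -` {j x} \<inter> k -` {k x}"]) (auto simp: q_def)
  qed
  ultimately show ?thesis by blast
qed

text \<open>
  Both \<open>f\<close> and the conjugate \<open>g\<close> move points along edges of the same graph \<open>R\<close>: if the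
  cells of \<open>x\<close> and \<open>g x\<close> are joined by an edge, some \<open>z\<close> in the cell of \<open>x\<close> has \<open>f z\<close> in
  the cell of \<open>g x\<close>. One quarter of \<open>e\<close> bounds the diameter of the cells, another one the
  oscillation of \<open>f\<close> on a cell.
\<close>
lemma minimal_conjugates_dense:
  fixes f0 f :: "'a::metric_space \<Rightarrow>\<^sub>C 'a"
  assumes X: "cantor_space (UNIV :: 'a set)" and f0: "f0 \<in> homeos" "minimal_map f0"
    and f: "f \<in> CM" and "e > 0"
  shows "\<exists>g\<in>conj_class f0. dist g f < e"
proof -
  have cpt: "compact (UNIV :: 'a set)" using X by (simp add: cantor_space_def)
  obtain g0 where fg: "homeomorphism UNIV UNIV f0 g0" using f0(1) by (auto simp: homeos_def)
  have "uniformly_continuous_on UNIV f" using cpt by (intro compact_uniformly_continuous) auto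
  then obtain d where d: "d > 0" "\<And>x y. dist x y < d \<Longrightarrow> dist (f x) (f y) < e / 4"
    using \<open>e > 0\<close> unfolding uniformly_continuous_on_def
    by (metis UNIV_I zero_less_divide_iff zero_less_numeral)
  obtain p :: "'a \<Rightarrow> nat" where p: "continuous_on UNIV p" and fine: "\<And>x y. p x = p y \<Longrightarrow> dist x y < min d (e / 4)"
    using fine_label[OF X, of "min d (e / 4)"] d(1) \<open>e > 0\<close> by auto
  let ?P = "range p"
  have finP: "finite ?P" by (rule finite_range_label[OF cpt p])
  define R where "R = {(p x, p (f x)) | x. True}"
  obtain r where r: "r > 0" "\<And>x y. dist x y < r \<Longrightarrow> p x = p y" using label_gap[OF cpt p] by blast
  obtain N where N: "\<And>x y. (x, y) \<in> chain_step r f ^^ N"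
    using f r(1) unfolding CM_def chain_mixing_iff by blast
  \<comment> \<open>A step of a chain with errors below the distance between cells is an edge of \<open>R\<close>.\<close>
  have "(p x, p y) \<in> R" if "(x, y) \<in> chain_step r f" for x y
    using that r(2) unfolding chain_step_iff R_def by fastforce
  then have "(p x, p y) \<in> R ^^ N" for x y using relpow_map[of "chain_step r f" p R] N by blast
  moreover have "(u, v) \<in> R ^^ m" if "m \<ge> N" "u \<in> ?P" "v \<in> ?P" for m u v
    using that(1,3)
  proof (induction m arbitrary: v rule: dec_induct)
    case base
    then show ?case using calculation that(2) by auto
  next
    case (step m)
    obtain y where "v = p y" using step.prems by auto
    moreover obtain x where "y = f x" using f by (auto simp: CM_def cont_surj_def dest: surjD)
    ultimately have "(p x, v) \<in> R" by (auto simp: R_def)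
    then show ?case using step.IH[of "p x"] by auto
  qed
  ultimately have full: "\<And>m u v. m \<ge> N \<Longrightarrow> u \<in> ?P \<Longrightarrow> v \<in> ?P \<Longrightarrow> (u, v) \<in> R ^^ m" by blast
  obtain x0 :: 'a where True by simp
  have "\<exists>M. \<forall>m\<ge>M. \<exists>c. visiting_walk R m (p x0) (p x0) ?P c"
    by (rule long_visiting_walks[of N ?P R]) (use full finP in auto)
  then obtain M where "\<forall>m\<ge>M. \<exists>c. visiting_walk R m (p x0) (p x0) ?P c" by blast
  then obtain c where c: "\<And>m. m \<ge> M \<Longrightarrow> visiting_walk R m (p x0) (p x0) ?P (c m)" by metis
  obtain U where U: "open U" "closed U" "x0 \<in> U" "\<And>x i. x \<in> U \<Longrightarrow> 1 \<le> i \<Longrightarrow> i < M \<Longrightarrow> (apply_bcontfun f0 ^^ i) x \<notin> U"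
    using clopen_long_return[OF X _ minimal_no_periodic_point[OF X f0(2)], of x0 M] by auto
  obtain q where q: "continuous_on UNIV q" "\<And>x. (q x, q (f0 x)) \<in> R" "?P \<subseteq> range q"
  proof -
    have "U \<noteq> {}" using U(3) by blast
    from tower_label[OF cpt fg f0(2) U(1,2) this U(4) c] that show ?thesis by blast
  qed
  have "range q \<subseteq> ?P" using q(2) by (force simp: R_def)
  then obtain h k where hk: "homeomorphism UNIV UNIV h k" "\<And>x. p (h x) = q x"
    using homeomorphism_matching_labels[OF X p q(1)] q(3) by blast
  have "continuous_on UNIV (h \<circ> f0 \<circ> k)"
    using hk(1) by (intro continuous_on_compose) (auto simp: homeomorphism_def intro: continuous_on_subset)
  then obtain g where g: "apply_bcontfun g = h \<circ> f0 \<circ> k" using continuous_imp_bcontfun[OF cpt] by blast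
  have "dist (g x) (f x) \<le> e / 2" for x
  proof -
    have "(p x, p (g x)) \<in> R"
    proof -
      have "h (k x) = x" using hk(1) by (simp add: homeomorphism_def)
      then have "p x = q (k x)" using hk(2)[of "k x"] by simp
      moreover have "p (g x) = q (f0 (k x))" using hk(2) by (simp add: g)
      ultimately show ?thesis using q(2)[of "k x"] by simp
    qed
    then obtain z where z: "p x = p z" "p (g x) = p (f z)" by (auto simp: R_def)
    have "dist (f z) (f x) < e / 4" using d(2) fine[OF z(1)] by (simp add: dist_commute)
    moreover have "dist (g x) (f z) < e / 4" using fine[OF z(2)] by simp
    ultimately show ?thesis using dist_triangle[of "g x" "f x" "f z"] by simp
  qed
  then have "dist g f \<le> e / 2" by (rule dist_bound)
  moreover have "g \<in> conj_class f0" by (rule conj_classI[OF cpt hk(1)]) (simp add: g)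
  ultimately show ?thesis using \<open>e > 0\<close> by (intro bexI[of _ g]) auto
qed

section \<open>The Chacon subshift\<close>

text \<open>
  Chacon's words are \<open>B 0 = 0\<close> and \<open>B (n + 1) = B n B n 1 B n\<close>. Each word is placed on the
  integers so that the middle copy in \<open>B (n + 1)\<close> keeps the position of \<open>B n\<close>; then the
  words extend each other in both directions and their union is a two-sided sequence. The
  left end of \<open>B n\<close> is at minus \<open>origin_pos n\<close>.
\<close>
primrec block_len :: "nat \<Rightarrow> int" where
  "block_len 0 = 1"
| "block_len (Suc n) = 3 * block_len n + 1"

primrec origin_pos :: "nat \<Rightarrow> int" where
  "origin_pos 0 = 0"
| "origin_pos (Suc n) = block_len n + origin_pos n"

definition block_dom :: "nat \<Rightarrow> int set" where
  "block_dom n = {- origin_pos n ..< block_len n - origin_pos n}"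

primrec block :: "nat \<Rightarrow> int \<Rightarrow> bool" where
  "block 0 j = False"
| "block (Suc n) j =
     (if j < - origin_pos n then block n (j + block_len n)
      else if j < block_len n - origin_pos n then block n j
      else j = block_len n - origin_pos n \<or> block n (j - block_len n - 1))"

definition chacon :: "int \<Rightarrow> bool" where
  "chacon j = block (nat \<bar>j\<bar>) j"

lemma block_bounds: "int n \<le> origin_pos n" "int n + 1 \<le> block_len n - origin_pos n"
proof -
  have "int n \<le> origin_pos n \<and> int n + 1 \<le> block_len n - origin_pos n"
    by (induction n) auto
  then show "int n \<le> origin_pos n" "int n + 1 \<le> block_len n - origin_pos n" by auto
qed

lemma block_len_ge_1: "1 \<le> block_len n"
  by (induction n) auto

lemma block_dom_mono: "n \<le> m \<Longrightarrow> block_dom n \<subseteq> block_dom m"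
proof (induction m rule: dec_induct)
  case (step m)
  have "block_dom m \<subseteq> block_dom (Suc m)" using block_len_ge_1[of m] by (auto simp: block_dom_def)
  with step show ?case by blast
qed simp

lemma block_stable: "n \<le> m \<Longrightarrow> j \<in> block_dom n \<Longrightarrow> block m j = block n j"
proof (induction m rule: dec_induct)
  case (step m)
  then have "j \<in> block_dom m" using block_dom_mono by blast
  with step show ?case by (auto simp: block_dom_def)
qed simp

lemma mem_block_dom: "\<bar>j\<bar> \<le> int n \<Longrightarrow> j \<in> block_dom n"
  using block_bounds[of n] by (auto simp: block_dom_def)

lemma chacon_eq_block: "j \<in> block_dom n \<Longrightarrow> chacon j = block n j"
proof -
  assume j: "j \<in> block_dom n"
  have "j \<in> block_dom (nat \<bar>j\<bar>)" by (rule mem_block_dom) simp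
  then have "block (max n (nat \<bar>j\<bar>)) j = chacon j" using block_stable by (simp add: chacon_def)
  moreover have "block (max n (nat \<bar>j\<bar>)) j = block n j" by (rule block_stable[OF _ j]) simp
  ultimately show ?thesis by simp
qed

lemma chacon_copies:
  assumes "j \<in> block_dom n"
  shows "chacon (j - block_len n) = chacon j" "chacon (j + block_len n + 1) = chacon j"
proof -
  have "j - block_len n \<in> block_dom (Suc n)" "j + block_len n + 1 \<in> block_dom (Suc n)"
    using assms block_len_ge_1[of n] by (auto simp: block_dom_def)
  then have "chacon (j - block_len n) = block (Suc n) (j - block_len n)"
    "chacon (j + block_len n + 1) = block (Suc n) (j + block_len n + 1)"
    using chacon_eq_block by blast+
  moreover have "block (Suc n) (j - block_len n) = block n j"
    "block (Suc n) (j + block_len n + 1) = block n j"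
    using assms by (auto simp: block_dom_def)
  ultimately show "chacon (j - block_len n) = chacon j" "chacon (j + block_len n + 1) = chacon j"
    using chacon_eq_block[OF assms] by simp_all
qed

lemma chacon_nonconstant: "\<not> chacon 0" "chacon 1"
  by (simp_all add: chacon_def)

text \<open>
  The integer \<open>p\<close> is the position of the origin of the block, not of its left end.
\<close>
definition occurs :: "nat \<Rightarrow> (int \<Rightarrow> bool) \<Rightarrow> int \<Rightarrow> bool" where
  "occurs n y p \<longleftrightarrow> (\<forall>j\<in>block_dom n. y (p + j) = chacon j)"

definition occurs_in_block :: "nat \<Rightarrow> nat \<Rightarrow> int \<Rightarrow> bool" where
  "occurs_in_block n m p \<longleftrightarrow> occurs n chacon p \<and>
     - origin_pos m \<le> p - origin_pos n \<and> p - origin_pos n + block_len n \<le> block_len m - origin_pos m"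

lemma occurs_in_block_refl: "occurs_in_block n n 0"
  by (simp add: occurs_in_block_def occurs_def)

lemma occurs_in_block_Suc:
  assumes "occurs_in_block n m p"
  shows "occurs_in_block n (Suc m) (p - block_len m)" "occurs_in_block n (Suc m) p"
    "occurs_in_block n (Suc m) (p + block_len m + 1)"
proof -
  have p: "occurs n chacon p" "- origin_pos m \<le> p - origin_pos n"
    "p - origin_pos n + block_len n \<le> block_len m - origin_pos m"
    using assms by (auto simp: occurs_in_block_def)
  have "p + j \<in> block_dom m" if "j \<in> block_dom n" for j
    using that p(2,3) by (auto simp: block_dom_def)
  note copies = chacon_copies[OF this]
  have "occurs n chacon (p - block_len m)" "occurs n chacon (p + block_len m + 1)"
    using p(1) copies by (auto simp: occurs_def algebra_simps)
  then show "occurs_in_block n (Suc m) (p - block_len m)" "occurs_in_block n (Suc m) p"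
    "occurs_in_block n (Suc m) (p + block_len m + 1)"
    using p block_len_ge_1[of m] by (auto simp: occurs_in_block_def)
qed

text \<open>
  Blocks of order \<open>n\<close> occur with bounded gaps, since \<open>B m\<close> is a concatenation of copies of
  \<open>B n\<close> with at most one spacer after each copy: this is why \<open>t\<close> may be one place beyond
  the right end of the block. The second part says that \<open>B m\<close> ends with \<open>B n\<close>, so that the
  spacer that follows a copy of \<open>B m\<close> is adjacent to a copy of \<open>B n\<close>.
\<close>
lemma block_tiling:
  assumes "n \<le> m"
  shows "(\<forall>t\<in>block_dom m. \<exists>p. occurs_in_block n m p \<and> p - origin_pos n \<le> t \<and> t \<le> p - origin_pos n + block_len n)
    \<and> occurs_in_block n m (block_len m - origin_pos m - block_len n + origin_pos n)"
  using assms
proof (induction m rule: dec_induct)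
  case base
  show ?case using occurs_in_block_refl[of n]
    by (auto simp: block_dom_def intro!: exI[of _ 0])
next
  case (step m)
  then have IH: "\<And>t. t \<in> block_dom m \<Longrightarrow>
      \<exists>p. occurs_in_block n m p \<and> p - origin_pos n \<le> t \<and> t \<le> p - origin_pos n + block_len n"
    and last: "occurs_in_block n m (block_len m - origin_pos m - block_len n + origin_pos n)" by auto
  have "\<exists>p. occurs_in_block n (Suc m) p \<and> p - origin_pos n \<le> t \<and> t \<le> p - origin_pos n + block_len n"
    if t: "t \<in> block_dom (Suc m)" for t
  proof -
    consider "t + block_len m \<in> block_dom m" | "t \<in> block_dom m" | "t = block_len m - origin_pos m"
      | "t - block_len m - 1 \<in> block_dom m"
      using t unfolding block_dom_def by (simp only: atLeastLessThan_iff block_len.simps origin_pos.simps) linarith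
    then show ?thesis
    proof cases
      case 1
      then obtain p where "occurs_in_block n m p" "p - origin_pos n \<le> t + block_len m"
          "t + block_len m \<le> p - origin_pos n + block_len n" using IH by blast
      then show ?thesis using occurs_in_block_Suc(1) by (intro exI[of _ "p - block_len m"]) auto
    next
      case 2
      then show ?thesis using IH occurs_in_block_Suc(2) by blast
    next
      case 3
      then show ?thesis using occurs_in_block_Suc(2)[OF last] block_len_ge_1[of n]
        by (intro exI[of _ "block_len m - origin_pos m - block_len n + origin_pos n"]) auto
    next
      case 4
      then obtain p where "occurs_in_block n m p" "p - origin_pos n \<le> t - block_len m - 1"
          "t - block_len m - 1 \<le> p - origin_pos n + block_len n" using IH by blast
      then show ?thesis using occurs_in_block_Suc(3) by (intro exI[of _ "p + block_len m + 1"]) auto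
    qed
  qed
  moreover have "occurs_in_block n (Suc m) (block_len (Suc m) - origin_pos (Suc m) - block_len n + origin_pos n)"
  proof -
    have "block_len (Suc m) - origin_pos (Suc m) - block_len n + origin_pos n =
        block_len m - origin_pos m - block_len n + origin_pos n + block_len m + 1" by simp
    then show ?thesis using occurs_in_block_Suc(3)[OF last] by presburger
  qed
  ultimately show ?case by blast
qed

text \<open>
  The source of weak mixing. In \<open>B (m + 1)\<close> the distance from the first copy of \<open>B m\<close> to
  the second is the length of \<open>B m\<close>, and from the second to the third it is one more.
  Choosing freely between the two on each of \<open>L\<close> levels, one can add any \<open>e \<le> L\<close> to
  the sum of the lengths.
\<close>
lemma block_differences:
  assumes "e \<le> L"
  shows "\<exists>p. occurs_in_block n (n + L) p \<and> occurs_in_block n (n + L) (p + (\<Sum>i<L. block_len (n + i)) + int e)"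
  using assms
proof (induction L arbitrary: e)
  case 0
  then show ?case using occurs_in_block_refl[of n] by auto
next
  case (Suc L)
  show ?case
  proof (cases "e \<le> L")
    case True
    then obtain p where p: "occurs_in_block n (n + L) p"
        "occurs_in_block n (n + L) (p + (\<Sum>i<L. block_len (n + i)) + int e)" using Suc.IH by blast
    show ?thesis
      using occurs_in_block_Suc(1)[OF p(1)] occurs_in_block_Suc(2)[OF p(2)]
      by (intro exI[of _ "p - block_len (n + L)"]) (simp add: algebra_simps)
  next
    case False
    then have e: "e = Suc L" using Suc.prems by simp
    obtain p where p: "occurs_in_block n (n + L) p"
        "occurs_in_block n (n + L) (p + (\<Sum>i<L. block_len (n + i)) + int L)" using Suc.IH by blast
    show ?thesis
      using occurs_in_block_Suc(2)[OF p(1)] occurs_in_block_Suc(3)[OF p(2)]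
      by (intro exI[of _ p]) (simp add: algebra_simps e)
  qed
qed

definition shift :: "int \<Rightarrow> (int \<Rightarrow> bool) \<Rightarrow> int \<Rightarrow> bool" where
  "shift t y = (\<lambda>j. y (t + j))"

definition agree :: "nat \<Rightarrow> (int \<Rightarrow> bool) \<Rightarrow> (int \<Rightarrow> bool) \<Rightarrow> bool" where
  "agree l y z \<longleftrightarrow> (\<forall>j. \<bar>j\<bar> \<le> int l \<longrightarrow> y j = z j)"

text \<open>
  The orbit closure of the Chacon sequence under the shift.
\<close>
definition chacon_space :: "(int \<Rightarrow> bool) set" where
  "chacon_space = {y. \<forall>l. \<exists>t. agree l y (shift t chacon)}"

lemma shift_shift: "shift t (shift u y) = shift (u + t) y"
  by (simp add: shift_def algebra_simps)

lemma shift_0 [simp]: "shift 0 y = y"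
  by (simp add: shift_def)

lemma funpow_shift: "(shift 1 ^^ i) y = shift (int i) y"
  by (induction i) (simp_all add: shift_shift algebra_simps)

lemma continuous_on_shift: "continuous_on S (shift t)"
  unfolding shift_def
  by (intro continuous_on_coordinatewise_then_product continuous_on_subset[OF continuous_on_product_coordinates]) auto

lemma open_if_agree_closed:
  assumes "\<And>y z. y \<in> Z \<Longrightarrow> agree l y z \<Longrightarrow> z \<in> Z"
  shows "open Z"
proof (subst open_subopen, intro ballI)
  fix y assume y: "y \<in> Z"
  have "open {z. \<forall>i\<in>{- int l..int l}. z (id i) \<in> {y i}}"
    by (rule product_topology_basis') (auto simp: open_discrete)
  moreover have "{z. \<forall>i\<in>{- int l..int l}. z (id i) \<in> {y i}} \<subseteq> Z"
    using assms[OF y] by (auto simp: agree_def abs_le_iff)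
  moreover have "y \<in> {z. \<forall>i\<in>{- int l..int l}. z (id i) \<in> {y i}}" by simp
  ultimately show "\<exists>T. open T \<and> y \<in> T \<and> T \<subseteq> Z" by meson
qed

lemma open_imp_agree:
  assumes "open W" "y \<in> W"
  shows "\<exists>l. \<forall>z. agree l y z \<longrightarrow> z \<in> W"
proof -
  have "openin (product_topology (\<lambda>i. euclidean) UNIV) W" using assms(1) by (simp add: open_fun_def)
  from product_topology_open_contains_basis[OF this assms(2)]
  obtain V where V: "y \<in> Pi\<^sub>E UNIV V" "finite {i. V i \<noteq> UNIV}" "Pi\<^sub>E UNIV V \<subseteq> W" by auto
  have "finite ((\<lambda>i. nat \<bar>i\<bar>) ` {i. V i \<noteq> UNIV})" using V(2) by blast
  then obtain l where l: "\<forall>k \<in> (\<lambda>i. nat \<bar>i\<bar>) ` {i. V i \<noteq> UNIV}. k \<le> l"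
    by (meson finite_nat_set_iff_bounded_le)
  have "z \<in> W" if "agree l y z" for z
  proof -
    have "z i \<in> V i" for i
    proof (cases "V i = UNIV")
      case False
      then have "\<bar>i\<bar> \<le> int l" using l by auto
      then have "z i = y i" using that by (simp add: agree_def)
      then show ?thesis using V(1) by (auto simp: PiE_iff)
    qed simp
    then show ?thesis using V(3) by (auto simp: PiE_iff)
  qed
  then show ?thesis by blast
qed

lemma chacon_in_space: "shift t chacon \<in> chacon_space"
  by (auto simp: chacon_space_def agree_def)

lemma shift_chacon_space: 
  assumes "y \<in> chacon_space"
  shows "shift u y \<in> chacon_space"
proof -
  have "\<exists>t. agree l (shift u y) (shift t chacon)" for l
  proof -
    obtain t where t: "agree (l + nat \<bar>u\<bar>) y (shift t chacon)" using assms by (auto simp: chacon_space_def)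
    have "agree l (shift u y) (shift (t + u) chacon)"
      unfolding agree_def
    proof (intro allI impI)
      fix j :: int assume "\<bar>j\<bar> \<le> int l"
      then have "\<bar>u + j\<bar> \<le> int (l + nat \<bar>u\<bar>)" by auto
      then show "shift u y j = shift (t + u) chacon j"
        using t by (auto simp: agree_def shift_def algebra_simps)
    qed
    then show ?thesis by blast
  qed
  then show ?thesis by (simp add: chacon_space_def)
qed

lemma closed_chacon_space: "closed chacon_space"
proof -
  have "closed {y. \<exists>t. agree l y (shift t chacon)}" for l
    unfolding closed_def
    by (rule open_if_agree_closed[of _ l]) (auto simp: agree_def)
  then have "closed (\<Inter>l. {y. \<exists>t. agree l y (shift t chacon)})" by blast
  moreover have "(\<Inter>l. {y. \<exists>t. agree l y (shift t chacon)}) = chacon_space" by (auto simp: chacon_space_def)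
  ultimately show ?thesis by simp
qed

lemma compact_chacon_space: "compact chacon_space"
proof -
  have "compact_space (product_topology (\<lambda>i::int. euclidean :: bool topology) UNIV)"
    by (simp only: compact_space_product_topology) (simp add: compact_space_def finite_imp_compact)
  then have "compact (UNIV :: (int \<Rightarrow> bool) set)"
    by (simp add: euclidean_product_topology compact_space_def)
  from compact_Int_closed[OF this closed_chacon_space] show ?thesis by simp
qed

lemma block_recurs:
  assumes "y \<in> chacon_space"
  shows "\<exists>p\<ge>a. occurs n y p"
proof -
  obtain t where t: "agree (nat (\<bar>a\<bar> + 2 * block_len n)) y (shift t chacon)"
    using assms by (auto simp: chacon_space_def)
  let ?t = "t + a + block_len n"
  define m where "m = max n (nat \<bar>?t\<bar>)"
  have "?t \<in> block_dom m" by (rule mem_block_dom) (simp add: m_def)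
  moreover have "n \<le> m" by (simp add: m_def)
  ultimately obtain p where p: "occurs_in_block n m p" "p - origin_pos n \<le> ?t"
      "?t \<le> p - origin_pos n + block_len n"
    using block_tiling by blast
  have "y (p - t + j) = chacon j" if j: "j \<in> block_dom n" for j
  proof -
    have "\<bar>p - t + j\<bar> \<le> int (nat (\<bar>a\<bar> + 2 * block_len n))"
      using p(2,3) j block_len_ge_1[of n] by (auto simp: block_dom_def)
    then have "y (p - t + j) = chacon (p + j)" using t by (simp add: agree_def shift_def)
    also have "\<dots> = chacon j" using p(1) j by (simp add: occurs_in_block_def occurs_def)
    finally show ?thesis .
  qed
  moreover have "p - t \<ge> a" using p(3) block_bounds(1)[of n] by linarith
  ultimately show ?thesis unfolding occurs_def by blast
qed

text \<open>
  Every open set that meets the subshift contains translates of the cylinders of all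
  Chacon blocks of large order, so that minimality and weak mixing become statements about
  the positions of blocks.
\<close>
lemma open_contains_block:
  assumes "open W" "W \<inter> chacon_space \<noteq> {}"
  shows "\<exists>n t. \<forall>m\<ge>n. \<forall>y p. occurs m y p \<longrightarrow> shift (p + t) y \<in> W"
proof -
  obtain z where z: "z \<in> W" "z \<in> chacon_space" using assms(2) by blast
  obtain l where l: "\<And>y. agree l z y \<Longrightarrow> y \<in> W" using open_imp_agree[OF assms(1) z(1)] by blast
  obtain t where t: "agree l z (shift t chacon)" using z(2) by (auto simp: chacon_space_def)
  have "shift (p + t) y \<in> W" if m: "m \<ge> nat \<bar>t\<bar> + l" and p: "occurs m y p" for m y p
  proof (rule l)
    show "agree l z (shift (p + t) y)"
      unfolding agree_def
    proof (intro allI impI)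
      fix j :: int assume j: "\<bar>j\<bar> \<le> int l"
      then have "t + j \<in> block_dom m" using m by (intro mem_block_dom) auto
      then have "y (p + (t + j)) = chacon (t + j)" using p unfolding occurs_def by blast
      then show "z j = shift (p + t) y j" using t j by (simp add: agree_def shift_def add.assoc)
    qed
  qed
  then show ?thesis by blast
qed

lemma chacon_minimal:
  assumes "y \<in> chacon_space" "open W" "W \<inter> chacon_space \<noteq> {}"
  shows "\<exists>i\<ge>1. (shift 1 ^^ i) y \<in> W"
proof -
  obtain n t where nt: "\<And>p. occurs n y p \<Longrightarrow> shift (p + t) y \<in> W"
    using open_contains_block[OF assms(2,3)] by blast
  obtain p where p: "p \<ge> 1 - t" "occurs n y p" using block_recurs[OF assms(1)] by blast
  then have "(shift 1 ^^ nat (p + t)) y \<in> W" using nt by (simp add: funpow_shift)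
  then show ?thesis using p(1) by (intro exI[of _ "nat (p + t)"]) auto
qed

text \<open>
  A common time \<open>N\<close> for both pairs of open sets exists if two distances between
  occurrences of a block differ by a number \<open>d\<close> that is prescribed by the offsets of the
  four sets; any integer is such a difference by \<open>block_differences\<close>.
\<close>
lemma chacon_weak_mixing:
  assumes "open A" "open B" "open C" "open D"
    "A \<inter> chacon_space \<noteq> {}" "B \<inter> chacon_space \<noteq> {}" "C \<inter> chacon_space \<noteq> {}" "D \<inter> chacon_space \<noteq> {}"
  shows "\<exists>n\<ge>1. (\<exists>x\<in>A \<inter> chacon_space. (shift 1 ^^ n) x \<in> B) \<and> (\<exists>x\<in>C \<inter> chacon_space. (shift 1 ^^ n) x \<in> D)"
proof -
  obtain n1 t1 where 1: "\<And>m y p. m \<ge> n1 \<Longrightarrow> occurs m y p \<Longrightarrow> shift (p + t1) y \<in> A"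
    using open_contains_block[OF assms(1,5)] by blast
  obtain n2 t2 where 2: "\<And>m y p. m \<ge> n2 \<Longrightarrow> occurs m y p \<Longrightarrow> shift (p + t2) y \<in> B"
    using open_contains_block[OF assms(2,6)] by blast
  obtain n3 t3 where 3: "\<And>m y p. m \<ge> n3 \<Longrightarrow> occurs m y p \<Longrightarrow> shift (p + t3) y \<in> C"
    using open_contains_block[OF assms(3,7)] by blast
  obtain n4 t4 where 4: "\<And>m y p. m \<ge> n4 \<Longrightarrow> occurs m y p \<Longrightarrow> shift (p + t4) y \<in> D"
    using open_contains_block[OF assms(4,8)] by blast
  define n where "n = n1 + n2 + n3 + n4"
  define d where "d = (t2 - t1) - (t4 - t3)"
  define L where "L = nat (\<bar>t2 - t1\<bar> + \<bar>t4 - t3\<bar> + 1)"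
  define S where "S = (\<Sum>i<L. block_len (n + i))"
  have "(\<Sum>i<L. (1::int)) \<le> S" unfolding S_def by (intro sum_mono block_len_ge_1)
  then have S: "int L \<le> S" by simp
  have "nat (max 0 (- d)) \<le> L" "nat (max 0 d) \<le> L" by (auto simp: L_def d_def)
  from this[THEN block_differences, of n] obtain p q
    where pq: "occurs n chacon p" "occurs n chacon (p + S + max 0 (- d))"
      "occurs n chacon q" "occurs n chacon (q + S + max 0 d)"
    by (auto simp: occurs_in_block_def S_def)
  define N where "N = S + max 0 (- d) + t2 - t1"
  have N: "N \<ge> 1" "N = S + max 0 d + t4 - t3" using S by (auto simp: N_def d_def L_def)
  have eq: "(shift 1 ^^ nat N) (shift u chacon) = shift (u + N) chacon" for u
    using N(1) by (simp add: funpow_shift shift_shift)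
  have "shift (p + t1) chacon \<in> A \<inter> chacon_space" using 1[OF _ pq(1)] chacon_in_space by (simp add: n_def)
  moreover have "(shift 1 ^^ nat N) (shift (p + t1) chacon) \<in> B"
    using 2[OF _ pq(2)] unfolding eq by (simp add: n_def N_def algebra_simps)
  moreover have "shift (q + t3) chacon \<in> C \<inter> chacon_space" using 3[OF _ pq(3)] chacon_in_space by (simp add: n_def)
  moreover have "(shift 1 ^^ nat N) (shift (q + t3) chacon) \<in> D"
    using 4[OF _ pq(4)] unfolding eq by (simp add: n_def N(2) algebra_simps)
  ultimately show ?thesis using N(1) by (intro exI[of _ "nat N"]) auto
qed

lemma open_coordinate: "open {y :: int \<Rightarrow> bool. y i}" "closed {y :: int \<Rightarrow> bool. y i}"
proof -
  show "open {y :: int \<Rightarrow> bool. y i}"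
    by (rule open_if_agree_closed[of _ "nat \<bar>i\<bar>"]) (auto simp: agree_def)
  show "closed {y :: int \<Rightarrow> bool. y i}"
    unfolding closed_def by (rule open_if_agree_closed[of _ "nat \<bar>i\<bar>"]) (auto simp: agree_def)
qed

text \<open>
  By minimality the orbit of \<open>y\<close> visits both cylinders at the coordinate \<open>0\<close>, so it is not
  a single point.
\<close>
lemma chacon_no_fixed_point:
  assumes "y \<in> chacon_space"
  shows "shift 1 y \<noteq> y"
proof
  assume "shift 1 y = y"
  then have fixed: "(shift 1 ^^ i) y = y" for i by (induction i) auto
  have "chacon \<in> - {y. y 0} \<inter> chacon_space" "shift 1 chacon \<in> {y. y 0} \<inter> chacon_space"
    using chacon_nonconstant chacon_in_space[of 0] chacon_in_space[of 1] by (auto simp: shift_def)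
  then have "{y. y 0} \<inter> chacon_space \<noteq> {}" "- {y. y 0} \<inter> chacon_space \<noteq> {}" by blast+
  from this[THEN chacon_minimal[OF assms, rotated]] show False
    using open_coordinate[of 0] by (auto simp: fixed)
qed

text \<open>
  If \<open>y\<close> were isolated, weak mixing applied to the open singletons of \<open>y\<close> and of its image
  would give a time at which \<open>y\<close> arrives both at itself and at its image, so \<open>y\<close> would be
  a fixed point, which minimality excludes.
\<close>
lemma cantor_set_chacon_space: "cantor_set chacon_space"
proof -
  have "y islimpt chacon_space" if y: "y \<in> chacon_space" for y
  proof (rule islimptI, rule ccontr)
    fix T assume T: "y \<in> T" "open T" and "\<not> (\<exists>z\<in>chacon_space. z \<in> T \<and> z \<noteq> y)"
    then have isolated: "\<And>z. z \<in> chacon_space \<Longrightarrow> z \<in> T \<Longrightarrow> z = y" by blast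
    let ?T' = "shift (-1) -` T"
    have "open ?T'" using T(2) continuous_on_shift by (intro open_vimage) auto
    moreover have "shift 1 y \<in> ?T'" using T(1) by (simp add: shift_shift)
    ultimately obtain n where n: "\<exists>x\<in>T \<inter> chacon_space. (shift 1 ^^ n) x \<in> T"
        "\<exists>x\<in>T \<inter> chacon_space. (shift 1 ^^ n) x \<in> ?T'"
      using chacon_weak_mixing[of T T T ?T'] T y shift_chacon_space[OF y, of 1] by blast
    have "shift (int n) y \<in> T" "shift (int n - 1) y \<in> T"
      using n isolated by (auto simp: funpow_shift shift_shift algebra_simps)
    then have "shift (int n) y = y" "shift (int n - 1) y = y"
      using isolated shift_chacon_space[OF y] by blast+
    then have "shift 1 y = y" by (metis add.commute diff_add_cancel shift_shift)
    then show False using chacon_no_fixed_point[OF y] by simp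
  qed
  moreover have "\<exists>n. y \<in> {y. y (from_nat n)} \<longleftrightarrow> z \<notin> {y. y (from_nat n)}" if neq: "y \<noteq> z" for y z :: "int \<Rightarrow> bool"
  proof -
    obtain i where "y i \<noteq> z i" using neq by auto
    then show ?thesis by (intro exI[of _ "to_nat i"]) auto
  qed
  moreover have "chacon_space \<noteq> {}" using chacon_in_space by blast
  ultimately show ?thesis
    unfolding cantor_set_def using compact_chacon_space open_coordinate
    by (intro conjI exI[of _ "\<lambda>n. {y. y (from_nat n)}"]) auto
qed

section \<open>Conjugacy transitive elements\<close>

lemma exists_minimal_weak_mixing_homeo:
  assumes X: "cantor_space (UNIV :: 'a::metric_space set)"
  shows "\<exists>f :: 'a \<Rightarrow>\<^sub>C 'a. f \<in> homeos \<and> minimal_map f \<and> weak_mixing f \<and> f \<in> CM"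
proof -
  have cpt: "compact (UNIV :: 'a set)" using X by (simp add: cantor_space_def)
  have "(\<lambda>x::'a. 0::nat) -` {0} = UNIV" by auto
  then have "cantor_set (UNIV :: 'a set)"
    using cantor_set_vimage[OF X, of "\<lambda>x. 0" 0] by simp
  from homeomorphic_binary_sequences[OF this]
    homeomorphic_binary_sequences[OF cantor_set_chacon_space, unfolded homeomorphic_sym[of chacon_space]]
  have "(UNIV :: 'a set) homeomorphic chacon_space" by (rule homeomorphic_trans)
  then obtain h k where hk: "homeomorphism (UNIV :: 'a set) chacon_space h k" unfolding homeomorphic_def by blast
  have hY: "h x \<in> chacon_space" for x using hk by (auto simp: homeomorphism_def)
  have kh: "k (h x) = x" for x using hk by (auto simp: homeomorphism_def)
  have hk': "h (k y) = y" if "y \<in> chacon_space" for y using hk that by (auto simp: homeomorphism_def)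
  have cont: "continuous_on UNIV (\<lambda>x. k (shift t (h x)))" for t
  proof (rule continuous_on_compose2[of chacon_space k])
    show "continuous_on chacon_space k" using hk by (simp add: homeomorphism_def)
    show "continuous_on UNIV (\<lambda>x. shift t (h x))"
      by (rule continuous_on_compose2[OF continuous_on_shift[of UNIV]]) (use hk in \<open>auto simp: homeomorphism_def\<close>)
    show "(\<lambda>x. shift t (h x)) ` UNIV \<subseteq> chacon_space" using shift_chacon_space hY by auto
  qed
  obtain f :: "'a \<Rightarrow>\<^sub>C 'a" where f: "\<And>x. f x = k (shift 1 (h x))"
    using continuous_imp_bcontfun[OF cpt cont] by metis
  have "homeomorphism UNIV UNIV f (\<lambda>x. k (shift (- 1) (h x)))"
    by (rule homeomorphismI) (auto simp: f hk' kh hY shift_chacon_space shift_shift cont)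
  then have homeo: "f \<in> homeos" and "surj f" by (auto simp: homeos_def homeomorphism_def)
  moreover have "minimal_map f"
    by (rule conjugate_dynamics(1)[OF hk shift_chacon_space f chacon_minimal])
  moreover have wm: "weak_mixing f"
    by (rule conjugate_dynamics(2)[OF hk shift_chacon_space f chacon_weak_mixing])
  moreover have "chain_mixing f" by (rule weak_mixing_imp_chain_mixing[OF X _ wm]) simp
  ultimately show ?thesis by (auto simp: CM_def cont_surj_def)
qed

lemma conj_class_dynamics:
  fixes f g :: "'a::metric_space \<Rightarrow>\<^sub>C 'a"
  assumes g: "g \<in> conj_class f"
  shows "f \<in> homeos \<Longrightarrow> g \<in> homeos"
    and "minimal_map f \<Longrightarrow> minimal_map g"
    and "weak_mixing f \<Longrightarrow> weak_mixing g"
proof -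
  obtain h k where hk: "homeomorphism UNIV UNIV h k" and gf: "\<And>x. g x = h (f (k x))"
    using conj_classE[OF g] by blast
  have kh: "homeomorphism UNIV UNIV k h" using hk by (simp add: homeomorphism_symD)
  show "g \<in> homeos" if fh: "f \<in> homeos"
  proof -
    obtain f' where "homeomorphism UNIV UNIV f f'" using fh by (auto simp: homeos_def)
    from homeomorphism_compose[OF homeomorphism_compose[OF kh this] hk]
    have "homeomorphism UNIV UNIV (h \<circ> (f \<circ> k)) (h \<circ> f' \<circ> k)" .
    moreover have "h \<circ> (f \<circ> k) = g" by (simp add: fun_eq_iff gf)
    ultimately show ?thesis by (auto simp: homeos_def)
  qed
  show "minimal_map g" if "minimal_map f"
    by (rule conjugate_dynamics(1)[where f = g and s = f, OF kh UNIV_I gf])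
       (use that in \<open>auto simp: minimal_map_iff\<close>)
  show "weak_mixing g" if "weak_mixing f"
    by (rule conjugate_dynamics(2)[where f = g and s = f, OF kh UNIV_I gf]) (use that[unfolded weak_mixing_iff] in auto)
qed

lemma minimal_homeo_conj_transitive:
  fixes f :: "'a::metric_space \<Rightarrow>\<^sub>C 'a"
  assumes X: "cantor_space (UNIV :: 'a set)" and f: "f \<in> homeos" "minimal_map f" "f \<in> CM"
  shows "conj_transitive_element CM f"
proof -
  have cpt: "compact (UNIV :: 'a set)" using X by (simp add: cantor_space_def)
  have sub: "conj_class f \<subseteq> CM" using conj_class_CM[OF cpt f(3)] by blast
  have "top_of_set cont_surj closure_of conj_class f \<subseteq> CM"
    by (rule closure_of_minimal[OF sub closedin_CM])
  moreover have "CM \<subseteq> top_of_set cont_surj closure_of conj_class f"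
  proof
    fix g :: "'a \<Rightarrow>\<^sub>C 'a" assume g: "g \<in> CM"
    then have "g \<in> closure (conj_class f)"
      using minimal_conjugates_dense[OF X f(1,2) g] by (auto simp: closure_approachable)
    moreover have "cont_surj \<inter> conj_class f = conj_class f" using sub by (auto simp: CM_def)
    ultimately show "g \<in> top_of_set cont_surj closure_of conj_class f"
      using g by (simp add: closure_of_subtopology CM_def)
  qed
  ultimately show ?thesis using f(3) by (auto simp: conj_transitive_element_def)
qed

text \<open>
  A minimal map \<open>m\<close> in \<open>CM\<close> has no point of period \<open>n\<close>, so by compactness \<open>m\<^sup>n\<close>
  moves all points by a fixed amount, and so does \<open>g\<^sup>n\<close> for all \<open>g\<close> close to \<open>m\<close>;
  but some conjugate of \<open>f\<close> is close to \<open>m\<close>.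
\<close>
lemma conj_transitive_no_periodic_point:
  fixes f :: "'a::metric_space \<Rightarrow>\<^sub>C 'a"
  assumes X: "cantor_space (UNIV :: 'a set)" and f: "conj_transitive_element CM f"
  shows "\<not> periodic_point f x"
proof
  assume "periodic_point f x"
  then obtain n where n: "n \<ge> 1" "(apply_bcontfun f ^^ n) x = x" by (auto simp: periodic_point_def)
  have cpt: "compact (UNIV :: 'a set)" using X by (simp add: cantor_space_def)
  obtain m :: "'a \<Rightarrow>\<^sub>C 'a" where m: "minimal_map m" "m \<in> CM"
    using exists_minimal_weak_mixing_homeo[OF X] by blast
  let ?D = "\<lambda>y. dist ((apply_bcontfun m ^^ n) y) y"
  have "continuous_on UNIV (apply_bcontfun m ^^ n)" by (intro continuous_on_funpow) simp
  then have "continuous_on UNIV ?D" by (intro continuous_on_dist continuous_on_id)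
  then obtain y0 where y0: "\<And>y. ?D y0 \<le> ?D y"
    using continuous_attains_inf[OF cpt] by blast
  have "?D y0 > 0"
    using minimal_no_periodic_point[OF X m(1)] n(1) by (auto simp: periodic_point_def)
  then obtain d where d: "d > 0"
      "\<And>g y. dist m g < d \<Longrightarrow> dist ((apply_bcontfun m ^^ n) y) ((apply_bcontfun g ^^ n) y) < ?D y0"
    using funpow_uniformly_close[OF cpt] by metis
  have "m \<in> closure (conj_class f)"
    using f m(2) closure_mono[of "cont_surj \<inter> conj_class f" "conj_class f"]
    by (auto simp: conj_transitive_element_def closure_of_subtopology)
  then obtain g where g: "g \<in> conj_class f" "dist m g < d"
    using d(1) by (auto simp: closure_approachable dist_commute)
  obtain h k where hk: "homeomorphism UNIV UNIV h k" and gf: "\<And>x. g x = h (f (k x))"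
    using conj_classE[OF g(1)] by blast
  have "h ((apply_bcontfun f ^^ n) x) = (apply_bcontfun g ^^ n) (h x)"
    by (rule semiconj_funpow) (use hk in \<open>simp add: gf homeomorphism_def\<close>)
  then have "(apply_bcontfun g ^^ n) (h x) = h x" by (simp add: n(2))
  then show False using d(2)[OF g(2), of "h x"] y0[of "h x"] by simp
qed

lemma funpow_same_labels_upto:
  fixes f :: "'a::metric_space \<Rightarrow>\<^sub>C 'a" and p :: "'a \<Rightarrow> nat"
  assumes cpt: "compact (UNIV :: 'a set)" and p: "continuous_on UNIV p"
  shows "\<exists>d>0. \<forall>g. dist f g < d \<longrightarrow>
    (\<forall>i\<le>N. \<forall>x. p ((apply_bcontfun g ^^ i) x) = p ((apply_bcontfun f ^^ i) x))"
proof (induction N)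
  case 0
  show ?case by (intro exI[of _ 1]) simp
next
  case (Suc N)
  then obtain d where d: "d > 0" "\<And>g i x. dist f g < d \<Longrightarrow> i \<le> N \<Longrightarrow>
      p ((apply_bcontfun g ^^ i) x) = p ((apply_bcontfun f ^^ i) x)" by blast
  obtain d' where d': "d' > 0" "\<And>g x. dist f g < d' \<Longrightarrow>
      p ((apply_bcontfun g ^^ Suc N) x) = p ((apply_bcontfun f ^^ Suc N) x)"
    using funpow_same_labels[OF cpt p, of f "Suc N"] by blast
  have *: "p ((apply_bcontfun g ^^ i) x) = p ((apply_bcontfun f ^^ i) x)"
    if g: "dist f g < min d d'" and i: "i \<le> Suc N" for g i x
  proof (cases "i = Suc N")
    case True
    show ?thesis unfolding True by (rule d'(2)) (use g in simp)
  next
    case False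
    show ?thesis by (rule d(2)) (use g i False in auto)
  qed
  show ?case
  proof (intro exI conjI allI impI)
    show "min d d' > 0" using d(1) d'(1) by simp
  qed (rule *)
qed

lemma openin_CM_if:
  assumes "\<And>f. f \<in> CM \<Longrightarrow> Q f \<Longrightarrow> \<exists>d>0. \<forall>g\<in>CM. dist f g < d \<longrightarrow> Q g"
  shows "openin (top_of_set CM) {f \<in> CM. Q f}"
  unfolding openin_euclidean_subtopology_iff
  using assms by (auto simp: dist_commute)

lemma gdelta_in_INT_open:
  assumes "\<And>i::'i::countable. openin X (A i)"
  shows "gdelta_in X (\<Inter>i. A i)"
proof (rule gdelta_in_Inter)
  show "gdelta_in X S" if "S \<in> range A" for S using that assms open_imp_gdelta_in by blast
qed auto

text \<open>
  The distance of \<open>f x\<close> and \<open>f y\<close> has a positive minimum on the compact set of pairs at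
  distance at least \<open>r\<close>.
\<close>
lemma separating_open:
  fixes f :: "'a::metric_space \<Rightarrow>\<^sub>C 'a"
  assumes cpt: "compact (UNIV :: 'a set)" and f: "\<And>x y. r \<le> dist x y \<Longrightarrow> f x \<noteq> f y"
  shows "\<exists>d>0. \<forall>g. dist f g < d \<longrightarrow> (\<forall>x y. r \<le> dist x y \<longrightarrow> g x \<noteq> g y)"
proof (cases "\<exists>x y :: 'a. r \<le> dist x y")
  case False
  then show ?thesis by (intro exI[of _ 1]) auto
next
  case True
  let ?K = "{z :: 'a \<times> 'a. r \<le> dist (fst z) (snd z)}"
  have "compact (UNIV \<times> UNIV :: ('a \<times> 'a) set)" using cpt by (intro compact_Times)
  moreover have "closed ?K" by (intro closed_Collect_le continuous_intros)
  ultimately have K: "compact ?K" using compact_Int_closed by fastforce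
  have "continuous_on ?K (\<lambda>z. dist (f (fst z)) (f (snd z)))"
    by (intro continuous_on_dist continuous_on_compose2[of UNIV f _ fst] continuous_on_compose2[of UNIV f _ snd]
        continuous_on_fst continuous_on_snd continuous_on_id) simp_all
  moreover have "?K \<noteq> {}" using True by auto
  ultimately obtain z0 where z0: "z0 \<in> ?K" "\<And>z. z \<in> ?K \<Longrightarrow>
      dist (f (fst z0)) (f (snd z0)) \<le> dist (f (fst z)) (f (snd z))"
    using continuous_attains_inf[OF K] by blast
  let ?d = "dist (f (fst z0)) (f (snd z0))"
  have "?d > 0" using f z0(1) by simp
  moreover have "g x \<noteq> g y" if g: "dist f g < ?d / 2" and xy: "r \<le> dist x y" for g x y
  proof
    assume eq: "g x = g y"
    have "dist (f x) (g x) < ?d / 2" "dist (g x) (f y) < ?d / 2"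
      using dist_fun_lt_imp_dist_val_lt[OF g, of x] dist_fun_lt_imp_dist_val_lt[OF g, of y] eq
      by (simp_all add: dist_commute)
    then have "dist (f x) (f y) < ?d" using dist_triangle_half_r[of "g x" "f x" ?d "f y"] by (simp add: dist_commute)
    then show False using z0(2)[of "(x, y)"] xy by simp
  qed
  ultimately show ?thesis by (intro exI[of _ "?d / 2"]) auto
qed

text \<open>
  A continuous map of a compact metric space onto itself is a homeomorphism as soon as it is
  injective, and injectivity is tested separately on the pairs at distance at least
  \<open>1 / (n + 1)\<close>.
\<close>
lemma gdelta_homeos_CM:
  assumes X: "cantor_space (UNIV :: 'a::metric_space set)"
  shows "gdelta_in (top_of_set CM) {f :: 'a \<Rightarrow>\<^sub>C 'a. f \<in> CM \<and> f \<in> homeos}"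
proof -
  have cpt: "compact (UNIV :: 'a set)" using X by (simp add: cantor_space_def)
  let ?A = "\<lambda>n. {f :: 'a \<Rightarrow>\<^sub>C 'a. f \<in> CM \<and> (\<forall>x y. inverse (real (Suc n)) \<le> dist x y \<longrightarrow> f x \<noteq> f y)}"
  have "gdelta_in (top_of_set CM) (\<Inter>n. ?A n)"
  proof (rule gdelta_in_INT_open, rule openin_CM_if)
    fix n and f :: "'a \<Rightarrow>\<^sub>C 'a"
    assume "\<forall>x y. inverse (real (Suc n)) \<le> dist x y \<longrightarrow> f x \<noteq> f y"
    then show "\<exists>d>0. \<forall>g\<in>CM. dist f g < d \<longrightarrow> (\<forall>x y. inverse (real (Suc n)) \<le> dist x y \<longrightarrow> g x \<noteq> g y)"
      using separating_open[OF cpt, of "inverse (real (Suc n))" f] by blast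
  qed
  moreover have "(\<Inter>n. ?A n) = {f. f \<in> CM \<and> f \<in> homeos}"
  proof (intro equalityI subsetI)
    fix f assume f: "f \<in> (\<Inter>n. ?A n)"
    have "inj f"
    proof (rule injI, rule ccontr)
      fix x y assume "f x = f y" "x \<noteq> y"
      then obtain n where "inverse (Suc n) < dist x y" using reals_Archimedean[of "dist x y"] by auto
      then show False using f \<open>f x = f y\<close> by (metis (mono_tags, lifting) INT_D UNIV_I less_imp_le mem_Collect_eq)
    qed
    moreover have "range f = UNIV" using f by (auto simp: CM_def cont_surj_def)
    ultimately have "f \<in> homeos"
      unfolding homeos_def using homeomorphism_compact[OF cpt, of f UNIV] by simp
    then show "f \<in> {f. f \<in> CM \<and> f \<in> homeos}" using f by auto
  next
    fix f :: "'a \<Rightarrow>\<^sub>C 'a" assume f: "f \<in> {f. f \<in> CM \<and> f \<in> homeos}"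
    then obtain k where "homeomorphism UNIV UNIV f k" by (auto simp: homeos_def)
    then have k: "k (f x) = x" for x by (simp add: homeomorphism_def)
    have "f x \<noteq> f y" if "inverse (real (Suc n)) \<le> dist x y" for n x y
    proof
      assume "f x = f y"
      then have "x = y" using k by metis
      then show False using that by simp
    qed
    then show "f \<in> (\<Inter>n. ?A n)" using f by blast
  qed
  ultimately show ?thesis by simp
qed

text \<open>
  A sequence of labels whose fibres form a basis of the topology. All fine enough labels
  have a fibre inside a given open set, so that several open sets can be treated with the
  same label.
\<close>
lemma label_basis:
  assumes X: "cantor_space (UNIV :: 'a::metric_space set)"
  shows "\<exists>p :: nat \<Rightarrow> 'a \<Rightarrow> nat. (\<forall>n. continuous_on UNIV (p n)) \<and>
    (\<forall>V. open V \<longrightarrow> V \<noteq> {} \<longrightarrow> (\<exists>N. \<forall>n\<ge>N. \<exists>v\<in>range (p n). p n -` {v} \<subseteq> V))"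
proof -
  have "\<forall>n. \<exists>q :: 'a \<Rightarrow> nat. continuous_on UNIV q \<and> (\<forall>x y. q x = q y \<longrightarrow> dist x y < inverse (Suc n))"
    by (intro allI fine_label[OF X]) simp
  then obtain p :: "nat \<Rightarrow> 'a \<Rightarrow> nat" where p: "\<And>n. continuous_on UNIV (p n)"
      "\<And>n x y. p n x = p n y \<Longrightarrow> dist x y < inverse (Suc n)"
    by metis
  have "\<exists>N. \<forall>n\<ge>N. \<exists>v\<in>range (p n). p n -` {v} \<subseteq> V" if V: "open V" "V \<noteq> {}" for V
  proof -
    obtain x where "x \<in> V" using V by blast
    then obtain e where e: "e > 0" "ball x e \<subseteq> V" using V(1) openE by blast
    obtain N where N: "inverse (Suc N) < e" using reals_Archimedean[OF e(1)] by auto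
    have "p n -` {p n x} \<subseteq> V" if "n \<ge> N" for n
    proof
      fix y assume "y \<in> p n -` {p n x}"
      then have "dist x y < inverse (Suc n)" using p(2)[of n x y] by simp
      also have "inverse (Suc n) \<le> inverse (Suc N)" using that by (simp add: field_simps)
      also note N
      finally show "y \<in> V" using e(2) by auto
    qed
    then show ?thesis by blast
  qed
  then show ?thesis using p(1) by blast
qed

text \<open>
  For a single clopen cell, the condition that all orbits visit it involves only boundedly
  many iterates, by compactness, hence it is open.
\<close>
lemma gdelta_minimal_CM:
  assumes X: "cantor_space (UNIV :: 'a::metric_space set)"
  shows "gdelta_in (top_of_set CM) {f :: 'a \<Rightarrow>\<^sub>C 'a. f \<in> CM \<and> minimal_map f}"
proof -
  have cpt: "compact (UNIV :: 'a set)" using X by (simp add: cantor_space_def)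
  obtain p :: "nat \<Rightarrow> 'a \<Rightarrow> nat" where p: "\<And>n. continuous_on UNIV (p n)"
    and basis: "\<And>V. open V \<Longrightarrow> V \<noteq> {} \<Longrightarrow> \<exists>N. \<forall>n\<ge>N. \<exists>v\<in>range (p n). p n -` {v} \<subseteq> V"
    using label_basis[OF X] by blast
  let ?Q = "\<lambda>n v f. v \<in> range (p n) \<longrightarrow> (\<forall>x. \<exists>i\<ge>1. p n ((apply_bcontfun f ^^ i) x) = v)"
  let ?A = "\<lambda>(n, v). {f \<in> CM. ?Q n v f}"
  have "gdelta_in (top_of_set CM) (\<Inter>i. ?A i)"
  proof (rule gdelta_in_INT_open)
    fix i :: "nat \<times> nat"
    obtain n v where i: "i = (n, v)" by fastforce
    have "openin (top_of_set CM) {f \<in> CM. ?Q n v f}"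
    proof (rule openin_CM_if)
      fix f :: "'a \<Rightarrow>\<^sub>C 'a" assume f: "?Q n v f"
      show "\<exists>d>0. \<forall>g\<in>CM. dist f g < d \<longrightarrow> ?Q n v g"
      proof (cases "v \<in> range (p n)")
        case False
        then show ?thesis by (intro exI[of _ 1]) auto
      next
        case True
        have "\<exists>N. \<forall>x. \<exists>i. 1 \<le> i \<and> i \<le> N \<and> (apply_bcontfun f ^^ i) x \<in> p n -` {v}"
          by (rule bounded_return[OF cpt]) (use f True vimage_label_open[OF p] in auto)
        then obtain N where N: "\<And>x. \<exists>i. 1 \<le> i \<and> i \<le> N \<and> p n ((apply_bcontfun f ^^ i) x) = v" by auto
        obtain d where d: "d > 0" "\<And>g i x. dist f g < d \<Longrightarrow> i \<le> N \<Longrightarrow>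
            p n ((apply_bcontfun g ^^ i) x) = p n ((apply_bcontfun f ^^ i) x)"
          using funpow_same_labels_upto[OF cpt p[of n], where f = f and N = N] by blast
        have "\<exists>i\<ge>1. p n ((apply_bcontfun g ^^ i) x) = v" if "dist f g < d" for g x
          using N[of x] d(2)[OF that] by metis
        then show ?thesis using d(1) by blast
      qed
    qed
    then show "openin (top_of_set CM) (?A i)" by (simp add: i)
  qed
  moreover have "minimal_map f \<longleftrightarrow> (\<forall>n v. ?Q n v f)" for f :: "'a \<Rightarrow>\<^sub>C 'a"
  proof
    assume f: "minimal_map f"
    show "\<forall>n v. ?Q n v f"
    proof (intro allI impI)
      fix n v x assume "v \<in> range (p n)"
      then have "open (p n -` {v})" "p n -` {v} \<noteq> {}" using vimage_label_open[OF p] by auto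
      then show "\<exists>i\<ge>1. p n ((apply_bcontfun f ^^ i) x) = v"
        using f unfolding minimal_map_iff by (metis vimage_singleton_eq)
    qed
  next
    assume f: "\<forall>n v. ?Q n v f"
    show "minimal_map f"
      unfolding minimal_map_iff
    proof (intro allI impI)
      fix x and V :: "'a set" assume "open V \<and> V \<noteq> {}"
      then obtain n where "\<exists>v\<in>range (p n). p n -` {v} \<subseteq> V" using basis by (meson order_refl)
      then obtain v where v: "v \<in> range (p n)" "p n -` {v} \<subseteq> V" by blast
      then show "\<exists>i\<ge>1. (apply_bcontfun f ^^ i) x \<in> V" using f by blast
    qed
  qed
  then have "(\<Inter>i. ?A i) = {f. f \<in> CM \<and> minimal_map f}" by auto
  ultimately show ?thesis by simp
qed

lemma gdelta_weak_mixing_CM: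
  assumes X: "cantor_space (UNIV :: 'a::metric_space set)"
  shows "gdelta_in (top_of_set CM) {f :: 'a \<Rightarrow>\<^sub>C 'a. f \<in> CM \<and> weak_mixing f}"
proof -
  have cpt: "compact (UNIV :: 'a set)" using X by (simp add: cantor_space_def)
  obtain p :: "nat \<Rightarrow> 'a \<Rightarrow> nat" where p: "\<And>n. continuous_on UNIV (p n)"
    and basis: "\<And>V. open V \<Longrightarrow> V \<noteq> {} \<Longrightarrow> \<exists>N. \<forall>n\<ge>N. \<exists>v\<in>range (p n). p n -` {v} \<subseteq> V"
    using label_basis[OF X] by blast
  let ?T = "\<lambda>n i u v f. \<exists>x. p n x = u \<and> p n ((apply_bcontfun f ^^ i) x) = v"
  let ?Q = "\<lambda>n u v u' v' f. {u, v, u', v'} \<subseteq> range (p n) \<longrightarrow> (\<exists>i\<ge>1. ?T n i u v f \<and> ?T n i u' v' f)"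
  let ?A = "\<lambda>(n, u, v, u', v'). {f \<in> CM. ?Q n u v u' v' f}"
  have "gdelta_in (top_of_set CM) (\<Inter>j. ?A j)"
  proof (rule gdelta_in_INT_open)
    fix j :: "nat \<times> nat \<times> nat \<times> nat \<times> nat"
    obtain n u v u' v' where j: "j = (n, u, v, u', v')" by (metis prod.exhaust)
    have "openin (top_of_set CM) {f \<in> CM. ?Q n u v u' v' f}"
    proof (rule openin_CM_if)
      fix f :: "'a \<Rightarrow>\<^sub>C 'a" assume f: "?Q n u v u' v' f"
      show "\<exists>d>0. \<forall>g\<in>CM. dist f g < d \<longrightarrow> ?Q n u v u' v' g"
      proof (cases "{u, v, u', v'} \<subseteq> range (p n)")
        case False
        then show ?thesis by (intro exI[of _ 1]) auto
      next
        case True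
        then obtain i where i: "i \<ge> 1" "?T n i u v f" "?T n i u' v' f" using f by blast
        obtain d where d: "d > 0" "\<And>g x. dist f g < d \<Longrightarrow>
            p n ((apply_bcontfun g ^^ i) x) = p n ((apply_bcontfun f ^^ i) x)"
          using funpow_same_labels[OF cpt p[of n], where f = f and n = i] by meson
        obtain x x' where x: "p n x = u" "p n ((apply_bcontfun f ^^ i) x) = v"
          "p n x' = u'" "p n ((apply_bcontfun f ^^ i) x') = v'" using i(2,3) by blast
        have "\<exists>i\<ge>1. ?T n i u v g \<and> ?T n i u' v' g" if g: "dist f g < d" for g
        proof (intro exI conjI)
          show "i \<ge> 1" "p n x = u" "p n x' = u'" by (rule i x)+
          show "p n ((apply_bcontfun g ^^ i) x) = v" "p n ((apply_bcontfun g ^^ i) x') = v'"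
            by (rule trans[OF d(2)[OF g]], rule x)+
        qed
        then show ?thesis using d(1) by meson
      qed
    qed
    then show "openin (top_of_set CM) (?A j)" by (simp add: j)
  qed
  moreover have "weak_mixing f \<longleftrightarrow> (\<forall>n u v u' v'. ?Q n u v u' v' f)" for f :: "'a \<Rightarrow>\<^sub>C 'a"
  proof
    assume f: "weak_mixing f"
    show "\<forall>n u v u' v'. ?Q n u v u' v' f"
    proof (intro allI impI)
      fix n u v u' v' assume "{u, v, u', v'} \<subseteq> range (p n)"
      then have "p n -` {u} \<noteq> {}" "p n -` {v} \<noteq> {}" "p n -` {u'} \<noteq> {}" "p n -` {v'} \<noteq> {}" by auto
      then show "\<exists>i\<ge>1. ?T n i u v f \<and> ?T n i u' v' f"
        using f[unfolded weak_mixing_iff, rule_format, of "p n -` {u}" "p n -` {v}" "p n -` {u'}" "p n -` {v'}"]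
          vimage_label_open[OF p] by blast
    qed
  next
    assume f: "\<forall>n u v u' v'. ?Q n u v u' v' f"
    show "weak_mixing f"
      unfolding weak_mixing_iff
    proof (intro allI impI)
      fix U V U' V' :: "'a set"
      assume *: "open U \<and> open V \<and> open U' \<and> open V' \<and> U \<noteq> {} \<and> V \<noteq> {} \<and> U' \<noteq> {} \<and> V' \<noteq> {}"
      obtain N1 where 1: "\<And>n. n \<ge> N1 \<Longrightarrow> \<exists>v\<in>range (p n). p n -` {v} \<subseteq> U" using basis[of U] * by blast
      obtain N2 where 2: "\<And>n. n \<ge> N2 \<Longrightarrow> \<exists>v\<in>range (p n). p n -` {v} \<subseteq> V" using basis[of V] * by blast
      obtain N3 where 3: "\<And>n. n \<ge> N3 \<Longrightarrow> \<exists>v\<in>range (p n). p n -` {v} \<subseteq> U'" using basis[of U'] * by blast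
      obtain N4 where 4: "\<And>n. n \<ge> N4 \<Longrightarrow> \<exists>v\<in>range (p n). p n -` {v} \<subseteq> V'" using basis[of V'] * by blast
      define n where "n = N1 + N2 + N3 + N4"
      have n: "n \<ge> N1" "n \<ge> N2" "n \<ge> N3" "n \<ge> N4" by (auto simp: n_def)
      obtain u where u: "u \<in> range (p n)" "p n -` {u} \<subseteq> U" using 1[OF n(1)] by blast
      obtain v where v: "v \<in> range (p n)" "p n -` {v} \<subseteq> V" using 2[OF n(2)] by blast
      obtain u' where u': "u' \<in> range (p n)" "p n -` {u'} \<subseteq> U'" using 3[OF n(3)] by blast
      obtain v' where v': "v' \<in> range (p n)" "p n -` {v'} \<subseteq> V'" using 4[OF n(4)] by blast
      have in_range: "{u, v, u', v'} \<subseteq> range (p n)" using u v u' v' by simp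
      note sub = u(2) v(2) u'(2) v'(2)
      from f[rule_format, OF in_range]
      obtain i where i: "i \<ge> 1" "?T n i u v f" "?T n i u' v' f" by (elim exE conjE) blast
      then have "(\<exists>x\<in>U. (apply_bcontfun f ^^ i) x \<in> V) \<and> (\<exists>x\<in>U'. (apply_bcontfun f ^^ i) x \<in> V')"
        using sub by blast
      then show "\<exists>i\<ge>1. (\<exists>x\<in>U. (apply_bcontfun f ^^ i) x \<in> V) \<and> (\<exists>x\<in>U'. (apply_bcontfun f ^^ i) x \<in> V')"
        using i(1) by blast
    qed
  qed
  then have "(\<Inter>j. ?A j) = {f. f \<in> CM \<and> weak_mixing f}" by auto
  ultimately show ?thesis by simp
qed

theorem theorem4p15:
  assumes "cantor_space (UNIV :: 'a::metric_space set)"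
  shows "conj_transitive (CM :: ('a \<Rightarrow>\<^sub>C 'a) set)
    \<and> (\<exists>f :: 'a \<Rightarrow>\<^sub>C 'a. f \<in> homeos \<and> minimal_map (apply_bcontfun f) \<and> conj_transitive_element CM f)
    \<and> (\<forall>f :: 'a \<Rightarrow>\<^sub>C 'a. conj_transitive_element CM f \<longrightarrow> (\<nexists>x. periodic_point (apply_bcontfun f) x))
    \<and> (let S = {f :: 'a \<Rightarrow>\<^sub>C 'a. f \<in> homeos \<and> weak_mixing (apply_bcontfun f)
                  \<and> minimal_map (apply_bcontfun f) \<and> conj_transitive_element CM f}
       in gdelta_in (top_of_set CM) S \<and> top_of_set CM closure_of S = CM)"
proof -
  have cpt: "compact (UNIV :: 'a set)" using assms by (simp add: cantor_space_def)
  obtain m :: "'a \<Rightarrow>\<^sub>C 'a" where m: "m \<in> homeos" "minimal_map m" "weak_mixing m" "m \<in> CM"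
    using exists_minimal_weak_mixing_homeo[OF assms] by blast
  have trans: "conj_transitive_element CM m" by (rule minimal_homeo_conj_transitive[OF assms m(1,2,4)])
  have "conj_invariant (CM :: ('a \<Rightarrow>\<^sub>C 'a) set)"
    using conj_class_CM[OF cpt] by (auto simp: conj_invariant_def)
  then have "conj_transitive (CM :: ('a \<Rightarrow>\<^sub>C 'a) set)"
    using closedin_CM trans by (auto simp: conj_transitive_def)
  let ?S = "{f :: 'a \<Rightarrow>\<^sub>C 'a. f \<in> homeos \<and> weak_mixing f \<and> minimal_map f \<and> conj_transitive_element CM f}"
  have S_eq: "?S = {f. f \<in> CM \<and> f \<in> homeos} \<inter> {f. f \<in> CM \<and> minimal_map f} \<inter> {f. f \<in> CM \<and> weak_mixing f}"
    using minimal_homeo_conj_transitive[OF assms] by (auto simp: conj_transitive_element_def)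
  have "gdelta_in (top_of_set CM) ?S"
    unfolding S_eq
    by (intro gdelta_in_Int gdelta_homeos_CM gdelta_minimal_CM gdelta_weak_mixing_CM assms)
  moreover have "top_of_set CM closure_of ?S = CM"
  proof (intro equalityI subsetI)
    fix f assume "f \<in> top_of_set CM closure_of ?S"
    then show "f \<in> CM" using closure_of_subset_topspace by fastforce
  next
    fix f :: "'a \<Rightarrow>\<^sub>C 'a" assume f: "f \<in> CM"
    have sub: "conj_class m \<subseteq> CM \<inter> ?S"
      using conj_class_dynamics[of _ m] conj_class_CM[OF cpt m(4)] m unfolding S_eq by blast
    have "f \<in> closure (conj_class m)"
      using minimal_conjugates_dense[OF assms m(1,2) f] by (auto simp: closure_approachable)
    then have "f \<in> closure (CM \<inter> ?S)" using closure_mono[OF sub] by blast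
    then show "f \<in> top_of_set CM closure_of ?S" using f by (simp add: closure_of_subtopology)
  qed
  ultimately show ?thesis
    unfolding Let_def
    using \<open>conj_transitive CM\<close> m(1,2) trans conj_transitive_no_periodic_point[OF assms] by blast
qed

end
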